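(* Let $X \in \mathcal{B}(L^2(\mathbb{T}))$. Then $X$ is a paired operator (that is, $X = S_{\varphi,\psi}$ for some $\varphi,\psi\in L^\infty(\mathbb{T})$) if and only if \[ X = M_z^* X M_z P_+ + M_z X M_z^* P_-. \] Moreover, if there exist $\varphi, \psi \in L^\infty(\mathbb{T})$ such that $X = S_{\varphi,\psi}$, then the symbols $\varphi$ and $\psi$ in the representation of $X$ are unique.
   Context: $\mathbb{T}$ is the unit circle; $\mathcal{B}(L^2(\mathbb{T}))$ is the space of bounded linear operators on $L^2(\mathbb{T})$ (normalized arc length measure). $H^2(\mathbb{T})$ is the closed subspace of $L^2(\mathbb{T})$ of functions whose Fourier coefficients of negative index all vanish. $P_+$ is the orthogonal projection of $L^2(\mathbb{T})$ onto $H^2(\mathbb{T})$ and $P_- = I_{L^2(\mathbb{T})} - P_+$. For $\varphi\in L^\infty(\mathbb{T})$, $M_\varphi$ is the operator of multiplication by $\varphi$ on $L^2(\mathbb{T})$; $M_z$ is multiplication by the coordinate function $z$. For $\varphi,\psi\in L^\infty(\mathbb{T})$ the paired operator $S_{\varphi,\psi}: L^2(\mathbb{T})\to L^2(\mathbb{T})$ is defined by $S_{\varphi,\psi} = M_\varphi P_+ + M_\psi P_-$. Elements of $L^\infty(\mathbb{T})$ are identified when equal almost everywhere. *)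

theory Defs
  imports "HOL-Analysis.Analysis"
begin

definition circle :: "complex measure" where
  "circle = distr (uniform_measure lborel {0..<2 * pi}) (restrict_space borel (sphere 0 1)) cis"

lemma cis_measurable_circle:
  "cis \<in> measurable (uniform_measure lborel {0..<2 * pi}) (restrict_space borel (sphere 0 1))"
proof (rule measurable_restrict_space2)
  have "cis \<in> borel_measurable borel"
    by (intro borel_measurable_continuous_onI continuous_intros)
  then show "cis \<in> borel_measurable (uniform_measure lborel {0..<2 * pi})"
    by (simp add: measurable_def)
qed simp

lemma space_circle: "space circle = sphere 0 1"
  by (simp add: circle_def space_restrict_space)

lemma sets_circle: "sets circle = sets (restrict_space borel (sphere 0 1))"
  by (simp add: circle_def)

lemma emeasure_space_circle: "emeasure circle (space circle) = 1"
proof -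
  have "emeasure circle (sphere 0 1) =
      emeasure (uniform_measure lborel {0..<2 * pi})
        (cis -` sphere 0 1 \<inter> space (uniform_measure lborel {0..<2 * pi}))"
    unfolding circle_def
    by (rule emeasure_distr[OF cis_measurable_circle]) (simp add: sets_restrict_space_iff)
  also have "cis -` sphere 0 1 \<inter> space (uniform_measure lborel {0..<2 * pi}) = UNIV"
    by auto
  also have "emeasure (uniform_measure lborel {0..<2 * pi}) UNIV = 1"
    using emeasure_uniform_measure_1[of lborel "{0..<2 * pi}"] by simp
  finally show ?thesis
    by (simp add: space_circle)
qed

lemma borel_measurable_circleI:
  "f \<in> borel_measurable borel \<Longrightarrow> f \<in> borel_measurable circle"
  by (subst measurable_cong_sets[OF sets_circle refl]) (rule measurable_restrict_space1)

definition sq_integrable :: "(complex \<Rightarrow> complex) \<Rightarrow> bool" where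
  "sq_integrable f \<longleftrightarrow>
     f \<in> borel_measurable circle \<and> integrable circle (\<lambda>z. (norm (f z))\<^sup>2)"

definition l2_eq :: "(complex \<Rightarrow> complex) \<Rightarrow> (complex \<Rightarrow> complex) \<Rightarrow> bool" where
  "l2_eq f g \<longleftrightarrow> sq_integrable f \<and> sq_integrable g \<and> (AE z in circle. f z = g z)"

lemma sq_integrable_measurable [measurable_dest]:
  "sq_integrable f \<Longrightarrow> f \<in> borel_measurable circle"
  by (simp add: sq_integrable_def)

lemma sq_integrable_zero: "sq_integrable (\<lambda>_. 0)"
  by (simp add: sq_integrable_def)

lemma norm_add_sq_le:
  fixes a b :: complex
  shows "(norm (a + b))\<^sup>2 \<le> 2 * (norm a)\<^sup>2 + 2 * (norm b)\<^sup>2"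
proof -
  have "(norm (a + b))\<^sup>2 \<le> (norm a + norm b)\<^sup>2"
    by (intro power_mono norm_triangle_ineq) auto
  also have "\<dots> \<le> 2 * (norm a)\<^sup>2 + 2 * (norm b)\<^sup>2"
    using sum_squares_bound[of "norm a" "norm b"] by (simp add: power2_sum)
  finally show ?thesis .
qed

lemma sq_integrable_add:
  assumes "sq_integrable f" "sq_integrable g"
  shows "sq_integrable (\<lambda>z. f z + g z)"
proof -
  note [measurable] = assms[THEN sq_integrable_measurable]
  have "integrable circle (\<lambda>z. (norm (f z + g z))\<^sup>2)"
  proof (rule Bochner_Integration.integrable_bound)
    show "integrable circle (\<lambda>z. 2 * (norm (f z))\<^sup>2 + 2 * (norm (g z))\<^sup>2)"
      using assms by (simp add: sq_integrable_def)
    show "AE z in circle.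
        norm ((norm (f z + g z))\<^sup>2) \<le> norm (2 * (norm (f z))\<^sup>2 + 2 * (norm (g z))\<^sup>2)"
      using norm_add_sq_le by (intro AE_I2) simp
  qed measurable
  then show ?thesis
    by (simp add: sq_integrable_def)
qed

lemma sq_integrable_cmult: "sq_integrable f \<Longrightarrow> sq_integrable (\<lambda>z. c * f z)"
  by (auto simp: sq_integrable_def norm_mult power_mult_distrib)

lemma integrable_mult_cnj:
  assumes "sq_integrable f" "sq_integrable g"
  shows "integrable circle (\<lambda>z. f z * cnj (g z))"
proof (rule Bochner_Integration.integrable_bound)
  note [measurable] = assms[THEN sq_integrable_measurable]
  show "integrable circle (\<lambda>z. (norm (f z))\<^sup>2 + (norm (g z))\<^sup>2)"
    using assms by (simp add: sq_integrable_def)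
  have "(\<lambda>z. cnj (g z)) \<in> borel_measurable circle"
    by (rule measurable_compose[OF _ borel_measurable_continuous_onI, of g])
       (auto intro: continuous_intros)
  then show "(\<lambda>z. f z * cnj (g z)) \<in> borel_measurable circle"
    by measurable
  have "norm (a * cnj b) \<le> norm ((norm a)\<^sup>2 + (norm b)\<^sup>2)" for a b :: complex
  proof -
    have "2 * (norm a * norm b) \<le> (norm a)\<^sup>2 + (norm b)\<^sup>2"
      using sum_squares_bound[of "norm a" "norm b"] by simp
    moreover have "0 \<le> norm a * norm b" by simp
    ultimately have "norm a * norm b \<le> (norm a)\<^sup>2 + (norm b)\<^sup>2" by linarith
    then show ?thesis by (simp add: norm_mult)
  qed
  then show "AE z in circle. norm (f z * cnj (g z)) \<le> norm ((norm (f z))\<^sup>2 + (norm (g z))\<^sup>2)"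
    by simp
qed

quotient_type l2 = "complex \<Rightarrow> complex" / partial: l2_eq
proof (rule part_equivpI)
  show "\<exists>f. l2_eq f f"
    using sq_integrable_zero by (auto simp: l2_eq_def)
  show "symp l2_eq"
    by (auto simp: symp_def l2_eq_def elim: eventually_mono)
  show "transp l2_eq"
  proof (rule transpI)
    fix f g h assume "l2_eq f g" "l2_eq g h"
    moreover from this have "AE z in circle. f z = g z" "AE z in circle. g z = h z"
      by (simp_all add: l2_eq_def)
    then have "AE z in circle. f z = h z"
      by eventually_elim simp
    ultimately show "l2_eq f h" by (simp add: l2_eq_def)
  qed
qed

lift_definition scaleC :: "complex \<Rightarrow> l2 \<Rightarrow> l2" (infixr \<open>*\<^sub>C\<close> 75)
  is "\<lambda>c f z. c * f z"
  by (auto simp: l2_eq_def intro: sq_integrable_cmult)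

lift_definition cinner :: "l2 \<Rightarrow> l2 \<Rightarrow> complex"
  is "\<lambda>f g. integral\<^sup>L circle (\<lambda>z. f z * cnj (g z))"
proof (rule integral_cong_AE)
  fix f f' g g' assume *: "l2_eq f f'" "l2_eq g g'"
  then show "(\<lambda>z. f z * cnj (g z)) \<in> borel_measurable circle"
    "(\<lambda>z. f' z * cnj (g' z)) \<in> borel_measurable circle"
    by (auto simp: l2_eq_def intro!: borel_measurable_integrable integrable_mult_cnj)
  have "AE z in circle. f z = f' z" "AE z in circle. g z = g' z"
    using * by (simp_all add: l2_eq_def)
  then show "AE z in circle. f z * cnj (g z) = f' z * cnj (g' z)"
    by eventually_elim simp
qed

text \<open>
  The real inner product is the real part of the complex one, so that norm, distance and topology
  of the type \<open>l2\<close> are the usual ones, and the library's \<^const>\<open>bounded_linear\<close> applies.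
\<close>

instantiation l2 :: real_inner
begin

lift_definition zero_l2 :: l2 is "\<lambda>_. 0"
  by (simp add: l2_eq_def sq_integrable_zero)

lift_definition plus_l2 :: "l2 \<Rightarrow> l2 \<Rightarrow> l2" is "\<lambda>f g z. f z + g z"
  by (auto simp: l2_eq_def intro: sq_integrable_add elim: eventually_elim2)

definition uminus_l2 :: "l2 \<Rightarrow> l2" where "- f = (- 1) *\<^sub>C f"

definition minus_l2 :: "l2 \<Rightarrow> l2 \<Rightarrow> l2" where "f - g = f + - (g :: l2)"

definition scaleR_l2 :: "real \<Rightarrow> l2 \<Rightarrow> l2" where "r *\<^sub>R f = complex_of_real r *\<^sub>C f"

definition inner_l2 :: "l2 \<Rightarrow> l2 \<Rightarrow> real" where "f \<bullet> g = Re (cinner f g)"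

lift_definition norm_l2 :: "l2 \<Rightarrow> real" is "\<lambda>f. sqrt (integral\<^sup>L circle (\<lambda>z. (norm (f z))\<^sup>2))"
proof -
  fix f g assume "l2_eq f g"
  then have "integral\<^sup>L circle (\<lambda>z. (norm (f z))\<^sup>2) = integral\<^sup>L circle (\<lambda>z. (norm (g z))\<^sup>2)"
    by (intro integral_cong_AE) (auto simp: l2_eq_def sq_integrable_def elim: eventually_mono)
  then show "sqrt (integral\<^sup>L circle (\<lambda>z. (norm (f z))\<^sup>2)) =
      sqrt (integral\<^sup>L circle (\<lambda>z. (norm (g z))\<^sup>2))" by simp
qed

definition sgn_l2 :: "l2 \<Rightarrow> l2" where "sgn f = inverse (norm f) *\<^sub>R (f :: l2)"

definition dist_l2 :: "l2 \<Rightarrow> l2 \<Rightarrow> real" where "dist f g = norm (f - g)" for f g :: l2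

definition uniformity_l2 :: "(l2 \<times> l2) filter" where
  "uniformity_l2 = (INF e\<in>{0<..}. principal {(f, g). dist f g < e})"

definition open_l2 :: "l2 set \<Rightarrow> bool" where
  "open_l2 U \<longleftrightarrow> (\<forall>x\<in>U. eventually (\<lambda>(x', y). x' = x \<longrightarrow> y \<in> U) uniformity)"

lemma Re_mult_cnj_self: "Re (a * cnj a) = (norm a)\<^sup>2"
  unfolding cmod_power2 by (simp add: power2_eq_square)

lemma l2_self_inner: "f \<bullet> f = (norm f)\<^sup>2" for f :: l2
  unfolding inner_l2_def
proof transfer
  fix f assume "l2_eq f f"
  then have sq: "sq_integrable f" by (simp add: l2_eq_def)
  have "Re (integral\<^sup>L circle (\<lambda>z. f z * cnj (f z))) =
      integral\<^sup>L circle (\<lambda>z. Re (f z * cnj (f z)))"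
    by (rule integral_Re[symmetric]) (rule integrable_mult_cnj[OF sq sq])
  then show "Re (integral\<^sup>L circle (\<lambda>z. f z * cnj (f z))) =
      (sqrt (integral\<^sup>L circle (\<lambda>z. (norm (f z))\<^sup>2)))\<^sup>2"
    by (simp only: Re_mult_cnj_self) simp
qed

instance
proof
  fix f g h :: l2 and a b r :: real
  show "f + g + h = f + (g + h)"
    by transfer (auto simp: l2_eq_def add.assoc intro: sq_integrable_add)
  show "f + g = g + f"
    by transfer (auto simp: l2_eq_def add.commute intro: sq_integrable_add)
  show "0 + f = f"
    by transfer (auto simp: l2_eq_def)
  show "- f + f = 0"
    unfolding uminus_l2_def
    by transfer (auto simp: l2_eq_def sq_integrable_zero)
  show "f - g = f + - g"
    by (simp add: minus_l2_def)
  show "a *\<^sub>R (f + g) = a *\<^sub>R f + a *\<^sub>R g"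
    unfolding scaleR_l2_def
    by transfer (auto simp: l2_eq_def ring_distribs intro: sq_integrable_add sq_integrable_cmult)
  show "(a + b) *\<^sub>R f = a *\<^sub>R f + b *\<^sub>R f"
    unfolding scaleR_l2_def
    by transfer (auto simp: l2_eq_def ring_distribs intro: sq_integrable_add sq_integrable_cmult)
  show "a *\<^sub>R b *\<^sub>R f = (a * b) *\<^sub>R f"
    unfolding scaleR_l2_def
    by transfer (auto simp: l2_eq_def mult.assoc intro: sq_integrable_cmult)
  show "1 *\<^sub>R f = f"
    unfolding scaleR_l2_def
    by transfer (auto simp: l2_eq_def)
  show "dist f g = norm (f - g)" by (rule dist_l2_def)
  show "sgn f = inverse (norm f) *\<^sub>R f" by (rule sgn_l2_def)
  show "(uniformity :: (l2 \<times> l2) filter) = (INF e\<in>{0<..}. principal {(f, g). dist f g < e})"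
    by (rule uniformity_l2_def)
  show "open U \<longleftrightarrow> (\<forall>x\<in>U. eventually (\<lambda>(x', y). x' = x \<longrightarrow> y \<in> U) uniformity)"
    for U :: "l2 set"
    by (rule open_l2_def)
  have Re_cinner: "Re (integral\<^sup>L circle (\<lambda>z. u z * cnj (v z))) =
      integral\<^sup>L circle (\<lambda>z. Re (u z * cnj (v z)))"
    if "sq_integrable u" "sq_integrable v" for u v
    by (rule integral_Re[symmetric]) (rule integrable_mult_cnj[OF that])
  show "f \<bullet> g = g \<bullet> f"
    unfolding inner_l2_def
    by transfer (auto simp only: l2_eq_def Re_cinner intro!: Bochner_Integration.integral_cong,
        auto simp: algebra_simps)
  show "(f + g) \<bullet> h = f \<bullet> h + g \<bullet> h"
    unfolding inner_l2_def
    by transfer (auto simp: l2_eq_def ring_distribs integrable_mult_cnj)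
  show "r *\<^sub>R f \<bullet> g = r * (f \<bullet> g)"
    unfolding inner_l2_def scaleR_l2_def
    by transfer (simp add: mult.assoc)
  show "0 \<le> f \<bullet> f"
    by (simp add: l2_self_inner)
  show "norm f = sqrt (f \<bullet> f)"
    unfolding l2_self_inner by transfer (simp add: integral_nonneg_AE)
  show "f \<bullet> f = 0 \<longleftrightarrow> f = 0"
    unfolding l2_self_inner
  proof transfer
    fix f assume "l2_eq f f"
    then have sq: "sq_integrable f" by (simp add: l2_eq_def)
    then have "integral\<^sup>L circle (\<lambda>z. (norm (f z))\<^sup>2) = 0 \<longleftrightarrow> (AE z in circle. (norm (f z))\<^sup>2 = 0)"
      by (intro integral_nonneg_eq_0_iff_AE) (auto simp: sq_integrable_def)
    then show "(sqrt (integral\<^sup>L circle (\<lambda>z. (norm (f z))\<^sup>2)))\<^sup>2 = 0 \<longleftrightarrow> l2_eq f (\<lambda>_. 0)"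
      using sq by (simp add: l2_eq_def sq_integrable_zero)
  qed
qed

end

definition bounded_clinear :: "(l2 \<Rightarrow> l2) \<Rightarrow> bool" where
  "bounded_clinear A \<longleftrightarrow> bounded_linear A \<and> (\<forall>c f. A (c *\<^sub>C f) = c *\<^sub>C A f)"

text \<open>
  Adjoint with respect to the complex inner product, unlike the library's \<^const>\<open>adjoint\<close>, which
  uses the real one. The description is unique because the inner product is definite; it exists
  for every bounded operator by the Riesz representation theorem.
\<close>

definition cadjoint :: "(l2 \<Rightarrow> l2) \<Rightarrow> l2 \<Rightarrow> l2" where
  "cadjoint A = (THE B. \<forall>f g. cinner (A f) g = cinner f (B g))"

lift_definition fourier_coeff :: "l2 \<Rightarrow> int \<Rightarrow> complex"
  is "\<lambda>f n. integral\<^sup>L circle (\<lambda>z. f z * cnj (z powi n))"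
proof (rule ext, rule integral_cong_AE)
  fix f g :: "complex \<Rightarrow> complex" and n :: int assume *: "l2_eq f g"
  have [measurable]: "(\<lambda>z. cnj (z powi n)) \<in> borel_measurable circle"
  proof (rule borel_measurable_circleI)
    have "(\<lambda>z :: complex. z powi n) \<in> borel_measurable borel"
      unfolding power_int_def by measurable
    then show "(\<lambda>z. cnj (z powi n)) \<in> borel_measurable borel"
      by (rule measurable_compose[OF _ borel_measurable_continuous_onI])
         (auto intro: continuous_intros)
  qed
  have [measurable]: "f \<in> borel_measurable circle" "g \<in> borel_measurable circle"
    using * by (auto simp: l2_eq_def intro: sq_integrable_measurable)
  show "(\<lambda>z. f z * cnj (z powi n)) \<in> borel_measurable circle"
    "(\<lambda>z. g z * cnj (z powi n)) \<in> borel_measurable circle"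
    by measurable
  show "AE z in circle. f z * cnj (z powi n) = g z * cnj (z powi n)"
    using * by (auto simp: l2_eq_def elim: eventually_mono)
qed

definition H2 :: "l2 set" where
  "H2 = {f. \<forall>n<0. fourier_coeff f n = 0}"

text \<open>Well defined for closed complex subspaces \<open>V\<close>, such as \<open>H2\<close>.\<close>

definition orth_proj :: "l2 set \<Rightarrow> l2 \<Rightarrow> l2" where
  "orth_proj V f = (THE g. g \<in> V \<and> (\<forall>h\<in>V. cinner (f - g) h = 0))"

definition P_plus :: "l2 \<Rightarrow> l2" where
  "P_plus = orth_proj H2"

definition P_minus :: "l2 \<Rightarrow> l2" where
  "P_minus f = f - P_plus f"

definition ess_bounded :: "(complex \<Rightarrow> complex) \<Rightarrow> bool" where
  "ess_bounded \<phi> \<longleftrightarrow>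
     \<phi> \<in> borel_measurable circle \<and> (\<exists>C. AE z in circle. norm (\<phi> z) \<le> C)"

definition linf_eq :: "(complex \<Rightarrow> complex) \<Rightarrow> (complex \<Rightarrow> complex) \<Rightarrow> bool" where
  "linf_eq \<phi> \<psi> \<longleftrightarrow> ess_bounded \<phi> \<and> ess_bounded \<psi> \<and> (AE z in circle. \<phi> z = \<psi> z)"

quotient_type linf = "complex \<Rightarrow> complex" / partial: linf_eq
proof (rule part_equivpI)
  show "\<exists>f. linf_eq f f"
    by (rule exI[of _ "\<lambda>_. 0"]) (auto simp: linf_eq_def ess_bounded_def)
  show "symp linf_eq"
    by (auto simp: symp_def linf_eq_def elim: eventually_mono)
  show "transp linf_eq"
  proof (rule transpI)
    fix f g h assume "linf_eq f g" "linf_eq g h"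
    moreover from this have "AE z in circle. f z = g z" "AE z in circle. g z = h z"
      by (simp_all add: linf_eq_def)
    then have "AE z in circle. f z = h z"
      by eventually_elim simp
    ultimately show "linf_eq f h" by (simp add: linf_eq_def)
  qed
qed

lemma sq_integrable_mult:
  assumes "ess_bounded \<phi>" "sq_integrable f"
  shows "sq_integrable (\<lambda>z. \<phi> z * f z)"
proof -
  obtain C where C: "AE z in circle. norm (\<phi> z) \<le> C"
    using assms(1) by (auto simp: ess_bounded_def)
  have [measurable]: "\<phi> \<in> borel_measurable circle" "f \<in> borel_measurable circle"
    using assms by (auto simp: ess_bounded_def sq_integrable_def)
  have "integrable circle (\<lambda>z. (norm (\<phi> z * f z))\<^sup>2)"
  proof (rule Bochner_Integration.integrable_bound)
    show "integrable circle (\<lambda>z. C\<^sup>2 * (norm (f z))\<^sup>2)"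
      using assms(2) by (simp add: sq_integrable_def)
    show "AE z in circle. norm ((norm (\<phi> z * f z))\<^sup>2) \<le> norm (C\<^sup>2 * (norm (f z))\<^sup>2)"
      using C
    proof eventually_elim
      case (elim z)
      then have "(norm (\<phi> z))\<^sup>2 \<le> C\<^sup>2" by (intro power_mono) auto
      then show ?case
        by (auto simp: norm_mult power_mult_distrib intro: mult_right_mono)
    qed
  qed measurable
  then show ?thesis by (simp add: sq_integrable_def)
qed

lift_definition M :: "linf \<Rightarrow> l2 \<Rightarrow> l2" is "\<lambda>\<phi> f z. \<phi> z * f z"
proof -
  fix \<phi> \<psi> f g assume "linf_eq \<phi> \<psi>" "l2_eq f g"
  moreover from this have "AE z in circle. \<phi> z = \<psi> z" "AE z in circle. f z = g z"
    by (simp_all add: linf_eq_def l2_eq_def)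
  then have "AE z in circle. \<phi> z * f z = \<psi> z * g z"
    by eventually_elim simp
  ultimately show "l2_eq (\<lambda>z. \<phi> z * f z) (\<lambda>z. \<psi> z * g z)"
    by (auto simp: linf_eq_def l2_eq_def intro: sq_integrable_mult)
qed

lift_definition coord :: linf is "\<lambda>z. z"
proof -
  have "AE z in circle. norm z \<le> (1 :: real)"
    by (rule AE_I2) (simp add: space_circle)
  moreover have "(\<lambda>z. z) \<in> borel_measurable circle"
    by (rule borel_measurable_circleI) simp
  ultimately show "linf_eq (\<lambda>z. z) (\<lambda>z. z)"
    by (auto simp: linf_eq_def ess_bounded_def)
qed

definition paired :: "linf \<Rightarrow> linf \<Rightarrow> l2 \<Rightarrow> l2" where
  "paired \<phi> \<psi> f = M \<phi> (P_plus f) + M \<psi> (P_minus f)"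

definition is_paired :: "(l2 \<Rightarrow> l2) \<Rightarrow> bool" where
  "is_paired X \<longleftrightarrow> (\<exists>\<phi> \<psi>. X = paired \<phi> \<psi>)"

end

theory Submission
  imports Defs
begin

text \<open>
  On the monomials, a paired operator multiplies \<open>z\<^sup>n\<close> by \<open>\<phi>\<close> if \<open>n \<ge> 0\<close> and by \<open>\<psi>\<close> if \<open>n < 0\<close>.
  The operator equation says that \<open>X\<close> commutes with multiplication by \<open>z\<close> on the span of the
  nonnegative powers and with multiplication by \<open>z\<^sup>-\<^sup>1\<close> on the span of the negative ones. For a paired
  operator this holds because multiplications commute (\<open>paired_fixed\<close>). The symbols are read off from
  the images of \<open>1\<close> and \<open>z\<^sup>-\<^sup>1\<close>, which gives uniqueness (\<open>paired_unique\<close>).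

  Conversely, the equation forces \<open>X z\<^sup>n = z\<^sup>n X 1\<close> for \<open>n \<ge> 0\<close> and, with \<open>\<psi> = z X z\<^sup>-\<^sup>1\<close>,
  \<open>X z\<^sup>n = z\<^sup>n \<psi>\<close> for \<open>n < 0\<close> (\<open>fixed_imp_is_paired\<close>). A priori \<open>\<phi> = X 1\<close> and \<open>\<psi>\<close> are only square
  integrable. They are essentially bounded since a shift by a high power of \<open>z\<close>, which changes no
  norms, moves any trigonometric polynomial \<open>q\<close> into the half where \<open>X\<close> is multiplication, so that
  \<open>\<parallel>\<phi> q\<parallel> \<le> \<parallel>X\<parallel> \<parallel>q\<parallel>\<close> (\<open>ex_symbol\<close>); a duality argument with truncations of \<open>\<phi>\<close> then yields
  \<open>\<bar>\<phi>\<bar> \<le> \<parallel>X\<parallel>\<close> almost everywhere (\<open>bounded_multiplier\<close>). By continuity \<open>X\<close> agrees with the paired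
  operator on both halves of \<open>L\<^sup>2\<close> (\<open>bounded_clinear_eqI\<close>).

  All this rests on the monomials being an orthonormal basis of a Hilbert space. Completeness of \<open>l2\<close>
  is the Riesz-Fischer argument. A function with vanishing Fourier coefficients is zero, by
  Stone-Weierstrass and a Dynkin system argument (\<open>null_moments_AE_zero\<close>). Together with Bessel's
  inequality they give the Fourier expansion (\<open>has_sum_fourier\<close>), and with it the existence of the
  projection onto \<open>H2\<close> as truncation to nonnegative frequencies (\<open>fourier_coeff_P_plus\<close>).
\<close>

section \<open>The complex inner product\<close>

lemma cinner_add_left: "cinner (f + g) h = cinner f h + cinner g h"
  by transfer (auto simp: l2_eq_def ring_distribs integrable_mult_cnj)

lemma cinner_scaleC_left: "cinner (c *\<^sub>C f) g = c * cinner f g"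
  by transfer (simp add: mult.assoc)

lemma cinner_cnj: "cnj (cinner f g) = cinner g f"
proof transfer
  fix f g
  have "cnj (\<integral>z. f z * cnj (g z) \<partial>circle) = (\<integral>z. cnj (f z * cnj (g z)) \<partial>circle)"
    by (simp del: complex_cnj_mult)
  then show "cnj (\<integral>z. f z * cnj (g z) \<partial>circle) = (\<integral>z. g z * cnj (f z) \<partial>circle)"
    by (simp add: mult.commute)
qed

lemma cinner_scaleC_right: "cinner f (c *\<^sub>C g) = cnj c * cinner f g"
  by (metis cinner_cnj cinner_scaleC_left complex_cnj_mult)

lemma cinner_self: "cinner f f = (of_real (norm f))\<^sup>2"
proof -
  have "Im (cinner f f) = 0"
    using cinner_cnj[of f f] by (metis complex_cnj_cancel_iff Reals_cnj_iff complex_is_Real_iff)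
  moreover have "Re (cinner f f) = (norm f)\<^sup>2"
    using l2_self_inner[of f] by (simp add: inner_l2_def)
  ultimately show ?thesis
    by (simp add: complex_eq_iff)
qed

lemma norm_scaleC: "norm (c *\<^sub>C f) = norm c * norm f" for f :: l2
proof -
  have "(of_real ((norm (c *\<^sub>C f))\<^sup>2) :: complex) = cinner (c *\<^sub>C f) (c *\<^sub>C f)"
    by (simp add: cinner_self)
  also have "\<dots> = (c * cnj c) * cinner f f"
    by (simp add: cinner_scaleC_left cinner_scaleC_right mult.assoc)
  also have "\<dots> = of_real ((norm c * norm f)\<^sup>2)"
    by (simp add: cinner_self power_mult_distrib flip: complex_norm_square)
  finally have "(of_real ((norm (c *\<^sub>C f))\<^sup>2) :: complex) = of_real ((norm c * norm f)\<^sup>2)" .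
  then show ?thesis
    by (simp only: of_real_eq_iff) (simp add: power2_eq_iff_nonneg)
qed

text \<open>
  The norm comes from the real part of the inner product. Rotating \<open>f\<close> by a unimodular scalar makes
  the complex inner product real and nonnegative, which reduces the claim to the real Cauchy-Schwarz
  inequality.
\<close>

lemma norm_cinner_le: "norm (cinner f g) \<le> norm f * norm g"
proof (cases "cinner f g = 0")
  case False
  define c where "c = cnj (sgn (cinner f g))"
  have "norm c = 1" using False by (simp add: c_def norm_sgn)
  have "norm (cinner f g) = Re (c * cinner f g)"
    by (simp add: c_def sgn_eq complex_norm_square[symmetric] power2_eq_square mult.commute[of _ "cinner f g"])
  also have "\<dots> = (c *\<^sub>C f) \<bullet> g"
    by (simp add: inner_l2_def cinner_scaleC_left)
  also have "\<dots> \<le> norm (c *\<^sub>C f) * norm g"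
    by (rule norm_cauchy_schwarz)
  finally show ?thesis using \<open>norm c = 1\<close> by (simp add: norm_scaleC)
qed simp

lemma bounded_linear_cinner_left: "bounded_linear (\<lambda>f. cinner f g)"
proof (rule bounded_linear_intro[where K = "norm g"])
  show "cinner (r *\<^sub>R f) g = r *\<^sub>R cinner f g" for r f
    by (simp add: scaleR_l2_def cinner_scaleC_left scaleR_conv_of_real)
qed (simp_all add: cinner_add_left norm_cinner_le)

section \<open>Completeness of $L^2$\<close>

lemma sq_integrable_diff: "sq_integrable f \<Longrightarrow> sq_integrable g \<Longrightarrow> sq_integrable (\<lambda>z. f z - g z)"
  using sq_integrable_add[of f "\<lambda>z. (-1) * g z"] sq_integrable_cmult[of g "-1"] by simp

lemma minus_l2_abs:
  assumes "sq_integrable f" "sq_integrable g"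
  shows "abs_l2 f - abs_l2 g = abs_l2 (\<lambda>z. f z - g z)"
  using assms unfolding minus_l2_def uminus_l2_def
  by (simp add: scaleC.abs_eq plus_l2.abs_eq l2_eq_def sq_integrable_cmult[of _ "-1", simplified])

lemma ennreal_norm_abs_l2:
  assumes "sq_integrable f"
  shows "(\<integral>\<^sup>+z. ennreal ((norm (f z))\<^sup>2) \<partial>circle) = ennreal ((norm (abs_l2 f))\<^sup>2)"
  using assms
  by (subst nn_integral_eq_integral)
     (auto simp: sq_integrable_def norm_l2.abs_eq l2_eq_def)

lemma l2_cases:
  obtains f where "sq_integrable f" "x = abs_l2 f"
  using that by (induct x rule: l2.abs_induct) (auto simp: l2_eq_def)

text \<open>
  The weights \<open>2 ^ k\<close> still leave \<open>\<Sum>k. 2 ^ k * \<parallel>f (k+1) - f k\<parallel>\<^sup>2\<close> finite, so for almost every \<open>z\<close>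
  the series of the \<open>2 ^ k * \<bar>f (k+1) z - f k z\<bar>\<^sup>2\<close> converges. Since \<open>t \<le> (1/2)^k + 2^k * t\<^sup>2\<close> for \<open>t \<ge> 0\<close>, the
  pointwise increments are then absolutely summable.
\<close>

lemma AE_convergent_if_rapidly_Cauchy:
  fixes f :: "nat \<Rightarrow> complex \<Rightarrow> complex"
  assumes f: "\<And>k. sq_integrable (f k)"
    and le: "\<And>k. norm (abs_l2 (f (Suc k)) - abs_l2 (f k)) \<le> (1/2)^k"
  shows "AE z in circle. convergent (\<lambda>k. f k z)"
proof -
  note [measurable] = sq_integrable_measurable[OF f]
  let ?d = "\<lambda>k z. (norm (f (Suc k) z - f k z))\<^sup>2"
  have "(\<integral>\<^sup>+z. (\<Sum>k. ennreal (2 ^ k * ?d k z)) \<partial>circle)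
      = (\<Sum>k. \<integral>\<^sup>+z. ennreal (2 ^ k * ?d k z) \<partial>circle)"
    by (intro nn_integral_suminf) measurable
  also have "\<dots> = (\<Sum>k. ennreal (2 ^ k * (norm (abs_l2 (f (Suc k)) - abs_l2 (f k)))\<^sup>2))"
    by (simp add: ennreal_mult nn_integral_cmult ennreal_norm_abs_l2 sq_integrable_diff f minus_l2_abs)
  also have "\<dots> \<le> (\<Sum>k. ennreal ((1/2) ^ k))"
  proof (intro suminf_le ennreal_leI)
    fix k
    have "2 ^ k * (norm (abs_l2 (f (Suc k)) - abs_l2 (f k)))\<^sup>2 \<le> 2 ^ k * ((1/2) ^ k)\<^sup>2"
      using le[of k] by (intro mult_left_mono power_mono) auto
    also have "\<dots> = (1/2) ^ k"
      by (simp add: power2_eq_square power_divide)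
    finally show "2 ^ k * (norm (abs_l2 (f (Suc k)) - abs_l2 (f k)))\<^sup>2 \<le> (1/2) ^ k" .
  qed auto
  also have "\<dots> < \<infinity>"
    using summable_geometric[of "1/2::real"] by (simp add: suminf_ennreal2 less_top)
  finally have "AE z in circle. (\<Sum>k. ennreal (2 ^ k * ?d k z)) \<noteq> \<infinity>"
    by (intro nn_integral_noteq_infinite) auto
  then show ?thesis
  proof eventually_elim
    case (elim z)
    then have "summable (\<lambda>k. 2 ^ k * ?d k z)"
      by (intro summable_suminf_not_top) auto
    then have "summable (\<lambda>k. (1/2)^k + 2 ^ k * ?d k z)"
      by (intro summable_add summable_geometric) auto
    then have "summable (\<lambda>k. f (Suc k) z - f k z)"
    proof (rule summable_comparison_test'[where N = 0])
      fix k :: nat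
      \<comment> \<open>The slack in the claimed bound, written as a sum of squares.\<close>
      have "0 \<le> ((1 - 2 ^ k * norm (f (Suc k) z - f k z))\<^sup>2 + (1 + (2 ^ k * norm (f (Suc k) z - f k z))\<^sup>2)) / 2 ^ Suc k" by simp
      then show "norm (f (Suc k) z - f k z) \<le> (1/2)^k + 2 ^ k * ?d k z"
        by (simp add: field_simps power2_eq_square)
    qed
    then have "convergent (\<lambda>n. \<Sum>k<n. f (Suc k) z - f k z)"
      by (simp add: summable_iff_convergent)
    then have "convergent (\<lambda>n. f n z - f 0 z)"
      by (simp add: sum_lessThan_telescope[of "\<lambda>k. f k z"])
    then show ?case
      by (simp add: convergent_diff_const_right_iff)
  qed
qed

text \<open>
  Riesz-Fischer: a rapidly Cauchy subsequence has a pointwise limit \<open>g\<close> almost everywhere, and Fatou's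
  lemma turns the Cauchy estimate into a bound on the distance of its terms to \<open>g\<close>. That bound gives
  both the square integrability of \<open>g\<close> and the convergence to \<open>g\<close> in norm.
\<close>

instance l2 :: complete_space
proof
  fix X :: "nat \<Rightarrow> l2" assume X: "Cauchy X"
  have "\<forall>k. \<exists>N. \<forall>m\<ge>N. \<forall>n\<ge>N. norm (X m - X n) < (1/2)^k"
    using X by (simp add: Cauchy_iff)
  then obtain N where N: "\<And>k m n. m \<ge> N k \<Longrightarrow> n \<ge> N k \<Longrightarrow> norm (X m - X n) < (1/2)^k"
    by metis
  define r where "r k = (\<Sum>i\<le>k. N i) + k" for k
  have r: "strict_mono r" by (simp add: strict_mono_Suc_iff r_def)
  have rN: "N k \<le> r j" if "k \<le> j" for k j
    unfolding r_def using that by (intro trans_le_add1 member_le_sum) auto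
  have small: "norm (X (r m) - X (r k)) < (1/2)^k" if "k \<le> m" for k m
    using that by (intro N rN) auto
  have "\<forall>k. \<exists>f. sq_integrable f \<and> X (r k) = abs_l2 f" by (metis l2_cases)
  then obtain f where f: "\<And>k. sq_integrable (f k)" "\<And>k. X (r k) = abs_l2 (f k)" by metis
  note [measurable] = sq_integrable_measurable[OF f(1)]
  have conv: "AE z in circle. convergent (\<lambda>k. f k z)"
    using small[of _ "Suc _"] f by (intro AE_convergent_if_rapidly_Cauchy) (auto intro: less_imp_le)
  define g where "g z = lim (\<lambda>k. f k z)" for z
  have [measurable]: "g \<in> borel_measurable circle"
    unfolding g_def by measurable
  have lim: "AE z in circle. (\<lambda>k. f k z) \<longlonglongrightarrow> g z"
    using conv by eventually_elim (simp add: g_def convergent_LIMSEQ_iff)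
  have bound: "(\<integral>\<^sup>+z. ennreal ((norm (g z - f k z))\<^sup>2) \<partial>circle) \<le> ennreal (((1/2)^k)\<^sup>2)" for k
  proof -
    have "(\<integral>\<^sup>+z. ennreal ((norm (g z - f k z))\<^sup>2) \<partial>circle)
        = (\<integral>\<^sup>+z. liminf (\<lambda>m. ennreal ((norm (f m z - f k z))\<^sup>2)) \<partial>circle)"
    proof (rule nn_integral_cong_AE)
      show "AE z in circle. ennreal ((norm (g z - f k z))\<^sup>2)
          = liminf (\<lambda>m. ennreal ((norm (f m z - f k z))\<^sup>2))"
        using lim
      proof eventually_elim
        case (elim z)
        then have "(\<lambda>m. ennreal ((norm (f m z - f k z))\<^sup>2)) \<longlonglongrightarrow> ennreal ((norm (g z - f k z))\<^sup>2)"
          by (intro tendsto_intros)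
        then show ?case
          by (intro lim_imp_Liminf[symmetric]) simp
      qed
    qed
    also have "\<dots> \<le> liminf (\<lambda>m. \<integral>\<^sup>+z. ennreal ((norm (f m z - f k z))\<^sup>2) \<partial>circle)"
      by (intro nn_integral_liminf) measurable
    also have "\<dots> \<le> limsup (\<lambda>m. \<integral>\<^sup>+z. ennreal ((norm (f m z - f k z))\<^sup>2) \<partial>circle)"
      by (rule Liminf_le_Limsup) simp
    also have "\<dots> \<le> ennreal (((1/2)^k)\<^sup>2)"
    proof (rule Limsup_bounded)
      show "\<forall>\<^sub>F m in sequentially. (\<integral>\<^sup>+z. ennreal ((norm (f m z - f k z))\<^sup>2) \<partial>circle)
          \<le> ennreal (((1/2)^k)\<^sup>2)"
        using eventually_ge_at_top[of k]
      proof eventually_elim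
        case (elim m)
        have "(\<integral>\<^sup>+z. ennreal ((norm (f m z - f k z))\<^sup>2) \<partial>circle) = ennreal ((norm (X (r m) - X (r k)))\<^sup>2)"
          by (simp add: ennreal_norm_abs_l2 sq_integrable_diff f minus_l2_abs)
        also have "\<dots> \<le> ennreal (((1/2)^k)\<^sup>2)"
          using small[OF elim] by (intro ennreal_leI power_mono) auto
        finally show ?case .
      qed
    qed
    finally show ?thesis .
  qed
  have sq_diff: "sq_integrable (\<lambda>z. g z - f k z)" for k
    using bound[of k] unfolding sq_integrable_def
    by (auto intro!: integrableI_bounded intro: le_less_trans)
  then have g: "sq_integrable g"
    using sq_integrable_add[OF sq_diff[of 0] f(1)[of 0]] by simp
  have dist: "norm (X (r k) - abs_l2 g) \<le> (1/2)^k" for k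
  proof -
    have "ennreal ((norm (abs_l2 g - X (r k)))\<^sup>2) \<le> ennreal (((1/2)^k)\<^sup>2)"
      using bound[of k] by (simp add: ennreal_norm_abs_l2 sq_diff f minus_l2_abs g)
    then show ?thesis
      by (subst norm_minus_commute) (simp only: ennreal_le_iff zero_le_power2 power2_le_iff_abs_le, simp)
  qed
  have "(\<lambda>k. X (r k) - abs_l2 g) \<longlonglongrightarrow> 0"
    by (rule Lim_null_comparison[OF always_eventually LIMSEQ_realpow_zero[of "1/2"]]) (use dist in auto)
  then have "(X \<circ> r) \<longlonglongrightarrow> abs_l2 g"
    by (simp add: o_def LIM_zero_cancel)
  then show "convergent X"
    using Cauchy_converges_subseq[OF X r] by (auto simp: convergent_def)
qed

section \<open>Orthogonal series\<close>

lemma norm_sq_sum_orthogonal: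
  fixes v :: "'i \<Rightarrow> 'a :: real_inner"
  assumes "finite F" "\<And>i j. i \<in> F \<Longrightarrow> j \<in> F \<Longrightarrow> i \<noteq> j \<Longrightarrow> v i \<bullet> v j = 0"
  shows "(norm (\<Sum>i\<in>F. v i))\<^sup>2 = (\<Sum>i\<in>F. (norm (v i))\<^sup>2)"
  using norm_sum_Pythagorean[of F v] assms by (auto simp: pairwise_def orthogonal_def)

text \<open>
  By Pythagoras, the squared norm of the difference of two nested partial sums of \<open>v\<close> is the
  difference of the corresponding partial sums of \<open>\<parallel>v i\<parallel>\<^sup>2\<close>, a convergent series.
\<close>

lemma summable_on_orthogonal:
  fixes v :: "'i \<Rightarrow> 'a :: {real_inner, complete_space}"
  assumes orth: "\<And>i j. i \<noteq> j \<Longrightarrow> v i \<bullet> v j = 0"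
    and bound: "\<And>F. finite F \<Longrightarrow> (\<Sum>i\<in>F. (norm (v i))\<^sup>2) \<le> C"
  shows "v summable_on UNIV"
proof -
  let ?g = "\<lambda>i. (norm (v i))\<^sup>2"
  have "bdd_above (sum ?g ` {F. F \<subseteq> UNIV \<and> finite F})"
    using bound by (auto intro!: bdd_aboveI)
  then have "?g summable_on UNIV"
    by (intro nonneg_bdd_above_summable_on) auto
  then obtain L where L: "(?g has_sum L) UNIV"
    by (auto simp: summable_on_def)
  have "\<exists>P. eventually P (finite_subsets_at_top UNIV)
      \<and> (\<forall>F G. P F \<and> P G \<longrightarrow> dist (sum v F) (sum v G) < r)" if "r > 0" for r
  proof -
    define d where "d = r\<^sup>2 / 8"
    have "d > 0" using that by (simp add: d_def)
    have "\<forall>\<^sub>F F in finite_subsets_at_top UNIV. dist (sum ?g F) L < d"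
      using L \<open>d > 0\<close> unfolding has_sum_def tendsto_iff by blast
    then obtain H where H: "finite H" "\<And>F. finite F \<Longrightarrow> H \<subseteq> F \<Longrightarrow> dist (sum ?g F) L < d"
      unfolding eventually_finite_subsets_at_top by auto
    \<comment> \<open>Every partial sum beyond \<open>H\<close> is close to the one over \<open>H\<close>; two of them are compared through it.\<close>
    have near: "norm (sum v F - sum v H) < r / 2" if F: "finite F" "H \<subseteq> F" for F
    proof -
      have "(norm (sum v F - sum v H))\<^sup>2 = (norm (sum v (F - H)))\<^sup>2"
        using F by (simp add: sum_diff)
      also have "\<dots> = sum ?g (F - H)"
        using F orth by (intro norm_sq_sum_orthogonal) auto
      also have "\<dots> = sum ?g F - sum ?g H"
        using F by (simp add: sum_diff)
      also have "\<dots> < 2 * d"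
        using H(2)[OF F] H(2)[OF H(1)] by (auto simp: dist_real_def)
      also have "\<dots> = (r / 2)\<^sup>2" by (simp add: d_def power2_eq_square)
      finally show ?thesis
        by (rule power_less_imp_less_base) (use \<open>r > 0\<close> in simp)
    qed
    define P where "P F \<longleftrightarrow> finite F \<and> H \<subseteq> F" for F
    have "eventually P (finite_subsets_at_top UNIV)"
      using H(1) by (auto simp: P_def eventually_finite_subsets_at_top)
    moreover have "dist (sum v F) (sum v G) < r" if "P F" "P G" for F G
    proof (rule dist_triangle_half_l)
      show "dist (sum v F) (sum v H) < r / 2" "dist (sum v G) (sum v H) < r / 2"
        using near[of F] near[of G] that by (simp_all add: P_def dist_norm)
    qed
    ultimately show ?thesis by (intro exI[of _ P]) simp
  qed
  then have "cauchy_filter (filtermap (sum v) (finite_subsets_at_top UNIV))"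
    by (simp add: cauchy_filter_metric_filtermap)
  moreover have "complete (UNIV :: 'a set)"
    by (meson Cauchy_convergent UNIV_I complete_def convergent_def)
  ultimately obtain l where "(sum v \<longlongrightarrow> l) (finite_subsets_at_top UNIV)"
    using complete_uniform[where S=UNIV] by (force simp add: filterlim_def)
  then show ?thesis
    unfolding summable_on_def has_sum_def by blast
qed

instance l2 :: banach ..

section \<open>The monomials $z^n$\<close>

lemma finite_measure_circle: "finite_measure circle"
  by (rule finite_measureI) (simp add: emeasure_space_circle)

interpretation circle: finite_measure circle
  by (rule finite_measure_circle)

lemma measure_circle_space [simp]: "measure circle (sphere 0 1) = 1"
  using emeasure_space_circle by (simp add: measure_def space_circle)

lemma borel_measurable_powi [measurable]: "(\<lambda>z :: complex. z powi n) \<in> borel_measurable borel"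
  unfolding power_int_def by measurable

lemma borel_measurable_circle_powi [measurable]: "(\<lambda>z. z powi n) \<in> borel_measurable circle"
  by (rule borel_measurable_circleI) measurable

lemma norm_powi_circle: "z \<in> space circle \<Longrightarrow> norm (z powi n) = 1"
  by (simp add: space_circle norm_power_int)

lemma cnj_powi_circle: "z \<in> space circle \<Longrightarrow> cnj (z powi n) = z powi (- n)"
proof -
  assume "z \<in> space circle"
  then have "z * cnj z = 1"
    using complex_norm_square[of z] by (simp add: space_circle)
  then have "cnj z = inverse z"
    by (rule inverse_unique[symmetric])
  then show ?thesis
    by (simp add: power_int_minus power_int_inverse)
qed

lemma powi_add_circle: "z \<in> space circle \<Longrightarrow> z powi (m + n) = z powi m * z powi n"
  by (rule power_int_add) (auto simp: space_circle)

lemma ess_boundedI: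
  assumes "g \<in> borel_measurable circle" "\<And>z. z \<in> space circle \<Longrightarrow> norm (g z) \<le> C"
  shows "ess_bounded g"
  unfolding ess_bounded_def using assms by (auto intro!: exI[of _ C])

lemma ess_bounded_powi: "ess_bounded (\<lambda>z. z powi n)"
  by (rule ess_boundedI[of _ 1]) (auto simp: norm_powi_circle)

lemma ess_bounded_imp_sq_integrable: "ess_bounded g \<Longrightarrow> sq_integrable g"
  using sq_integrable_mult[of g "\<lambda>_. 1"] by (simp add: sq_integrable_def)

lift_definition zpow :: "int \<Rightarrow> linf" is "\<lambda>n z. z powi n"
  by (simp add: linf_eq_def ess_bounded_powi)

lift_definition monomial :: "int \<Rightarrow> l2" is "\<lambda>n z. z powi n"
  by (simp add: l2_eq_def ess_bounded_powi ess_bounded_imp_sq_integrable)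

lemma uniform_measure_eq_density:
  "uniform_measure lborel {0..<2 * pi} = density lborel (\<lambda>t. ennreal (indicator {0..<2*pi} t / (2 * pi)))"
  unfolding uniform_measure_def
  using divide_ennreal[of 1 "2 * pi"] by (intro arg_cong[of _ _ "density lborel"] ext) (simp split: split_indicator)

text \<open>
  The passage to the closed interval, where the fundamental theorem of calculus applies, changes only
  a null set.
\<close>

lemma integral_circle:
  fixes f :: "complex \<Rightarrow> complex"
  assumes [measurable]: "f \<in> borel_measurable borel"
  shows "(\<integral>z. f z \<partial>circle) = (\<integral>t. indicator {0..2*pi} t *\<^sub>R f (cis t) \<partial>lborel) / (2 * pi)"
proof -
  have [measurable]: "cis \<in> borel_measurable borel"
    by (intro borel_measurable_continuous_onI continuous_intros)
  have "(\<integral>z. f z \<partial>circle) = (\<integral>t. f (cis t) \<partial>uniform_measure lborel {0..<2 * pi})"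
    unfolding circle_def
    by (rule integral_distr[OF cis_measurable_circle]) (rule measurable_restrict_space1, measurable)
  also have "\<dots> = (\<integral>t. (indicator {0..<2*pi} t / (2 * pi)) *\<^sub>R f (cis t) \<partial>lborel)"
    unfolding uniform_measure_eq_density by (rule integral_density) auto
  also have "\<dots> = (\<integral>t. (indicator {0..2*pi} t *\<^sub>R f (cis t)) / (2 * pi) \<partial>lborel)"
  proof (rule integral_cong_AE)
    show "AE t in lborel. (indicator {0..<2*pi} t / (2 * pi)) *\<^sub>R f (cis t)
        = (indicator {0..2*pi} t *\<^sub>R f (cis t)) / (2 * pi)"
      using AE_lborel_singleton[of "2 * pi"]
      by eventually_elim (auto simp: indicator_def scaleR_conv_of_real)
  qed auto
  finally show ?thesis by simp
qed

lemma integral_circle_powi: "(\<integral>z. z powi n \<partial>circle) = of_bool (n = 0)"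
proof (cases "n = 0")
  case True
  then show ?thesis by (simp add: space_circle)
next
  case False
  have "(\<integral>t. indicator {0..2*pi} t *\<^sub>R cis t powi n \<partial>lborel)
      = cis (real_of_int n * (2*pi)) / (\<i> * n) - cis (real_of_int n * 0) / (\<i> * n)"
  proof (rule integral_FTC_Icc)
    fix t :: real
    have "((\<lambda>t. cis (real_of_int n * t) / (\<i> * n)) has_vector_derivative
        (n *\<^sub>R (\<i> * cis (n * t))) / (\<i> * n)) (at t within {0..2*pi})"
      unfolding has_vector_derivative_def using False
      by (auto intro!: derivative_eq_intros simp: scaleR_conv_of_real field_simps)
    then show "((\<lambda>t. cis (real_of_int n * t) / (\<i> * n)) has_vector_derivative cis t powi n)
        (at t within {0..2*pi})"
      using False by (simp add: cis_power_int scaleR_conv_of_real)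
  next
    show "continuous_on {0..2*pi} (\<lambda>t. cis t powi n)"
      by (simp add: cis_power_int) (intro continuous_intros)
  qed simp
  moreover have "cis (real_of_int n * (2*pi)) = 1"
    by (metis cis_multiple_2pi Ints_of_int mult.commute)
  ultimately show ?thesis
    using False by (simp add: integral_circle)
qed

section \<open>Functions with vanishing moments vanish\<close>

text \<open>
  As \<open>n\<close> runs over all integers, these are the Fourier coefficients in reversed order; writing them
  without a conjugate makes multiplication by a power of \<open>z\<close> a mere shift of the moments.
\<close>

definition null_moments :: "(complex \<Rightarrow> complex) \<Rightarrow> bool" where
  "null_moments h \<longleftrightarrow> integrable circle h \<and> (\<forall>n. (\<integral>z. h z * z powi n \<partial>circle) = 0)"

lemma integrable_mult_bounded:
  fixes h g :: "complex \<Rightarrow> complex"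
  assumes h: "integrable circle h" and g [measurable]: "g \<in> borel_measurable circle"
    and C: "\<And>z. z \<in> space circle \<Longrightarrow> norm (g z) \<le> C"
  shows "integrable circle (\<lambda>z. h z * g z)"
proof (rule Bochner_Integration.integrable_bound)
  show "integrable circle (\<lambda>z. C * norm (h z))" using h by simp
  show "(\<lambda>z. h z * g z) \<in> borel_measurable circle"
    using borel_measurable_integrable[OF h] by measurable
  show "AE z in circle. norm (h z * g z) \<le> norm (C * norm (h z))"
  proof (rule AE_I2)
    fix z assume z: "z \<in> space circle"
    have "norm (h z * g z) \<le> norm (h z) * C"
      using C[OF z] by (simp add: norm_mult mult_left_mono)
    then show "norm (h z * g z) \<le> norm (C * norm (h z))"
      by (simp add: mult.commute)
  qed
qed

lemma integrable_mult_indicator: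
  fixes h :: "complex \<Rightarrow> complex"
  assumes "integrable circle h" "B \<in> sets borel"
  shows "integrable circle (\<lambda>z. h z * indicator B z)"
proof (rule integrable_mult_bounded[where C = 1])
  show "indicator B \<in> borel_measurable circle"
    using assms by (intro borel_measurable_circleI) auto
qed (use assms in \<open>auto split: split_indicator\<close>)

lemma integrable_mult_powi:
  "integrable circle h \<Longrightarrow> integrable circle (\<lambda>z. h z * z powi n)" for h :: "complex \<Rightarrow> complex"
  by (rule integrable_mult_bounded[of _ _ 1]) (auto simp: norm_powi_circle)

lemma null_moments_cmult: "null_moments h \<Longrightarrow> null_moments (\<lambda>z. c * h z)"
  by (simp add: null_moments_def mult.assoc)

lemma null_moments_add:
  assumes "null_moments h" "null_moments k"
  shows "null_moments (\<lambda>z. h z + k z)"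
  using assms by (simp add: null_moments_def ring_distribs integrable_mult_powi)

lemma null_moments_powi:
  assumes "null_moments h"
  shows "null_moments (\<lambda>z. h z * z powi m)"
proof -
  have "(\<integral>z. h z * z powi m * z powi n \<partial>circle) = (\<integral>z. h z * z powi (m + n) \<partial>circle)" for n
    by (intro Bochner_Integration.integral_cong) (simp_all add: powi_add_circle mult.assoc)
  then show ?thesis
    using assms by (simp add: null_moments_def integrable_mult_powi)
qed

lemma null_moments_cong:
  assumes "null_moments h" "k \<in> borel_measurable circle" "AE z in circle. k z = h z"
  shows "null_moments k"
proof -
  have [measurable]: "h \<in> borel_measurable circle" "k \<in> borel_measurable circle"
    using assms by (auto simp: null_moments_def)
  have "integrable circle k"
    using assms(1,3) by (subst integrable_cong_AE[of _ _ h]) (auto simp: null_moments_def)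
  moreover have "(\<integral>z. k z * z powi n \<partial>circle) = (\<integral>z. h z * z powi n \<partial>circle)" for n
    using assms(3) by (intro integral_cong_AE) (auto elim: eventually_mono)
  ultimately show ?thesis
    using assms by (simp add: null_moments_def)
qed

text \<open>
  On the circle, a real-linear functional of \<open>z\<close> is a combination of \<open>z\<close> and \<open>z\<^sup>-\<^sup>1\<close>, and multiplication
  by a power of \<open>z\<close> only shifts the moments. Quantifying over all \<open>h\<close> makes the property of \<open>p\<close>
  stable under products, so the induction needs no explicit trigonometric polynomials.
\<close>

lemma null_moments_mult_polynomial:
  assumes "real_polynomial_function p" "null_moments h"
  shows "null_moments (\<lambda>z. h z * of_real (p z))"
  using assms
proof (induction p arbitrary: h)
  case (linear f)
  \<comment> \<open>The coefficient with \<open>f z = 2 * Re (a * z)\<close>.\<close>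
  define a where "a = Complex (f 1) (- f \<i>) / 2"
  have "null_moments (\<lambda>z. a * (h z * z powi 1) + cnj a * (h z * z powi (-1)))"
    by (intro null_moments_add null_moments_cmult null_moments_powi linear.prems)
  moreover have "AE z in circle. h z * of_real (f z) = a * (h z * z powi 1) + cnj a * (h z * z powi (-1))"
  proof (rule AE_I2)
    fix z assume z: "z \<in> space circle"
    interpret f: bounded_linear f by fact
    have "f z = f (Re z *\<^sub>R 1 + Im z *\<^sub>R \<i>)"
      by (rule arg_cong[of _ _ f]) (simp add: complex_eq_iff)
    also have "\<dots> = Re z * f 1 + Im z * f \<i>"
      by (simp only: f.add f.scaleR real_scaleR_def)
    finally have "of_real (f z) = a * z + cnj a * cnj z"
      by (simp add: a_def complex_eq_iff field_simps)
    also have "cnj z = z powi (-1)"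
      using cnj_powi_circle[OF z, of 1] by simp
    finally show "h z * of_real (f z) = a * (h z * z powi 1) + cnj a * (h z * z powi (-1))"
      by (simp add: algebra_simps)
  qed
  moreover have "(\<lambda>z. h z * of_real (f z)) \<in> borel_measurable circle"
  proof -
    have "f \<in> borel_measurable circle"
      using linear.hyps by (intro borel_measurable_circleI borel_measurable_continuous_onI
          linear_continuous_on)
    moreover have "h \<in> borel_measurable circle"
      using linear.prems by (auto simp: null_moments_def)
    ultimately show ?thesis by measurable
  qed
  ultimately show ?case
    using null_moments_cong by blast
next
  case (const c)
  then show ?case
    using null_moments_cmult[of h "of_real c"] by (simp add: mult.commute)
next
  case (add f g)
  then show ?case
    using null_moments_add[of "\<lambda>z. h z * of_real (f z)" "\<lambda>z. h z * of_real (g z)"]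
    by (simp add: ring_distribs)
next
  case (mult f g)
  then show ?case
    using mult.IH(2)[OF mult.IH(1)[OF mult.prems]] by (simp add: mult.assoc)
qed

lemma null_moments_integral: "null_moments h \<Longrightarrow> (\<integral>z. h z \<partial>circle) = 0"
  unfolding null_moments_def by (metis (no_types, lifting) Bochner_Integration.integral_cong mult.right_neutral power_int_0_right)

text \<open>
  By Stone-Weierstrass, \<open>g\<close> is uniformly close to a polynomial on the circle, and the polynomial
  contributes nothing to the integral.
\<close>

lemma null_moments_continuous:
  fixes g :: "complex \<Rightarrow> real"
  assumes h: "null_moments h" and g: "continuous_on UNIV g"
  shows "(\<integral>z. h z * of_real (g z) \<partial>circle) = 0"
proof -
  let ?I = "\<integral>z. h z * of_real (g z) \<partial>circle" and ?N = "\<integral>z. norm (h z) \<partial>circle"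
  have int: "integrable circle h" using h by (simp add: null_moments_def)
  have gm [measurable]: "g \<in> borel_measurable circle"
    using g by (intro borel_measurable_circleI borel_measurable_continuous_onI)
  have bound: "norm ?I \<le> r * (?N + 1)" if "r > 0" for r
  proof -
    obtain p where p: "real_polynomial_function p" "\<And>z. z \<in> sphere 0 1 \<Longrightarrow> \<bar>g z - p z\<bar> < r"
      using Stone_Weierstrass_real_polynomial_function[OF compact_sphere continuous_on_subset[OF g] \<open>r > 0\<close>]
      by (metis subset_UNIV)
    have hp: "null_moments (\<lambda>z. h z * of_real (p z))"
      by (rule null_moments_mult_polynomial) fact+
    have pm [measurable]: "p \<in> borel_measurable circle"
      using p(1) by (intro borel_measurable_circleI borel_measurable_continuous_onI
          continuous_at_imp_continuous_on ballI continuous_real_polymonial_function)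
    have int': "integrable circle (\<lambda>z. h z * of_real (g z - p z))"
      using p(2) int by (intro integrable_mult_bounded[where C = r]) (auto simp: space_circle less_imp_le simp flip: of_real_diff)
    have "?I = (\<integral>z. h z * of_real (g z - p z) + h z * of_real (p z) \<partial>circle)"
      by (simp add: algebra_simps)
    also have "\<dots> = (\<integral>z. h z * of_real (g z - p z) \<partial>circle)"
      using int' hp null_moments_integral[OF hp] by (subst Bochner_Integration.integral_add) (auto simp: null_moments_def)
    also have "norm \<dots> \<le> (\<integral>z. r * norm (h z) \<partial>circle)"
    proof (rule Bochner_Integration.integral_norm_bound_integral[OF int'])
      show "norm (h z * of_real (g z - p z)) \<le> r * norm (h z)" if "z \<in> space circle" for z
      proof -
        have "norm (h z) * \<bar>g z - p z\<bar> \<le> norm (h z) * r"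
          using p(2)[of z] that by (intro mult_left_mono) (auto simp: space_circle)
        then show ?thesis by (simp add: norm_mult mult.commute flip: of_real_diff)
      qed
    qed (use int in simp)
    also have "\<dots> = r * ?N" by simp
    also have "\<dots> \<le> r * (?N + 1)" using \<open>r > 0\<close> by simp
    finally show ?thesis .
  qed
  have pos: "?N + 1 > 0"
    by (intro add_nonneg_pos) simp_all
  have "norm ?I \<le> 0"
  proof (rule field_le_epsilon)
    fix d :: real assume "d > 0"
    then have "norm ?I \<le> d / (?N + 1) * (?N + 1)"
      using pos by (intro bound divide_pos_pos)
    also have "\<dots> = d"
      using pos by simp
    finally show "norm ?I \<le> 0 + d" by simp
  qed
  then show ?thesis by simp
qed

text \<open>
  The indicator of a closed set is the decreasing limit of the continuous tent functions
  \<open>max 0 (1 - k * infdist z C)\<close>.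
\<close>

lemma null_moments_closed:
  assumes h: "null_moments h" and C: "closed C"
  shows "(\<integral>z. h z * indicator C z \<partial>circle) = 0"
proof (cases "C = {}")
  case False
  define g where "g k z = max 0 (1 - real k * infdist z C)" for k :: nat and z :: complex
  have int: "integrable circle h" and hm [measurable]: "h \<in> borel_measurable circle"
    using h by (auto simp: null_moments_def)
  have gc: "continuous_on UNIV (g k)" for k
    unfolding g_def by (intro continuous_intros)
  then have [measurable]: "g k \<in> borel_measurable circle" for k
    by (intro borel_measurable_circleI borel_measurable_continuous_onI)
  have [measurable]: "indicator C \<in> borel_measurable circle"
    using C by (intro borel_measurable_circleI) auto
  have "(\<lambda>k. \<integral>z. h z * of_real (g k z) \<partial>circle) \<longlonglongrightarrow> (\<integral>z. h z * indicator C z \<partial>circle)"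
  proof (rule integral_dominated_convergence[where w = "\<lambda>z. norm (h z)"])
    show "AE z in circle. (\<lambda>k. h z * of_real (g k z)) \<longlonglongrightarrow> h z * indicator C z"
    proof (rule AE_I2)
      fix z
      have "(\<lambda>k. of_real (g k z) :: complex) \<longlonglongrightarrow> indicator C z"
      proof (cases "z \<in> C")
        case True
        then show ?thesis by (simp add: g_def)
      next
        case False
        then have pos: "infdist z C > 0"
          using C \<open>C \<noteq> {}\<close> in_closed_iff_infdist_zero infdist_nonneg by (metis less_eq_real_def)
        obtain K :: nat where K: "real K * infdist z C > 1"
          using reals_Archimedean3[OF pos] by blast
        have "g k z = 0" if "k \<ge> K" for k
        proof -
          have "real K * infdist z C \<le> real k * infdist z C"
            using that pos by (intro mult_right_mono) auto
          then show ?thesis using K by (simp add: g_def)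
        qed
        then have "\<forall>\<^sub>F k in sequentially. of_real (g k z) = (0 :: complex)"
          by (auto simp: eventually_sequentially)
        then show ?thesis
          using False by (simp add: tendsto_eventually)
      qed
      then show "(\<lambda>k. h z * of_real (g k z)) \<longlonglongrightarrow> h z * indicator C z"
        by (rule tendsto_mult_left)
    qed
    show "AE z in circle. norm (h z * of_real (g k z)) \<le> norm (h z)" for k
      by (intro AE_I2) (auto simp: norm_mult g_def infdist_nonneg intro!: mult_right_le_one_le)
  qed (use int in auto)
  then show ?thesis
    using null_moments_continuous[OF h gc] by (simp add: LIMSEQ_const_iff)
qed simp

text \<open>
  The sets with vanishing integral form a Dynkin system containing the closed sets, which are stable
  under intersection and generate the Borel sets.
\<close>

lemma null_moments_borel:
  assumes h: "null_moments h" and A: "A \<in> sets borel"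
  shows "(\<integral>z. h z * indicator A z \<partial>circle) = 0"
proof -
  have int: "integrable circle h" and hm [measurable]: "h \<in> borel_measurable circle"
    using h by (auto simp: null_moments_def)
  have ind [measurable]: "indicator B \<in> borel_measurable circle" if "B \<in> sets borel" for B :: "complex set"
    using that by (intro borel_measurable_circleI) auto
  note int_ind = integrable_mult_indicator[OF int]
  have stable: "Int_stable (Collect closed :: complex set set)"
    by (auto simp: Int_stable_def)
  have mem: "A \<in> sigma_sets UNIV (Collect closed)"
    using A by (simp add: borel_eq_closed)
  have sub: "Collect closed \<subseteq> Pow (UNIV :: complex set)" by simp
  from stable sub mem show ?thesis
  proof (induction rule: sigma_sets_induct_disjoint)
    case (basic C)
    then show ?case by (simp add: null_moments_closed[OF h])
  next
    case (compl B)
    then have B: "B \<in> sets borel" by (simp add: borel_eq_closed)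
    have "h z * indicator (UNIV - B) z = h z - h z * indicator B z" for z
      by (simp add: indicator_def)
    then show ?case
      using compl int_ind[OF B] int null_moments_integral[OF h] by simp
  next
    case (union B)
    then have B: "B i \<in> sets borel" for i by (auto simp: borel_eq_closed)
    have "(\<lambda>i. \<integral>z. h z * indicator (B i) z \<partial>circle) sums (\<integral>z. h z * indicator (\<Union>i. B i) z \<partial>circle)"
      unfolding sums_def
    proof -
      have "(\<lambda>n. \<integral>z. h z * indicator (\<Union>i<n. B i) z \<partial>circle) \<longlonglongrightarrow> (\<integral>z. h z * indicator (\<Union>i. B i) z \<partial>circle)"
      proof (rule integral_dominated_convergence[where w = "\<lambda>z. norm (h z)"])
        show "AE z in circle. (\<lambda>n. h z * indicator (\<Union>i<n. B i) z) \<longlonglongrightarrow> h z * indicator (\<Union>i. B i) z"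
          by (intro AE_I2 tendsto_mult_left LIMSEQ_indicator_UN)
        show "AE z in circle. norm (h z * indicator (\<Union>i<n. B i) z) \<le> norm (h z)" for n
          by (intro AE_I2) (auto split: split_indicator)
        show "(\<lambda>z. h z * indicator (\<Union>i. B i) z) \<in> borel_measurable circle"
          "(\<lambda>z. h z * indicator (\<Union>i<n. B i) z) \<in> borel_measurable circle" for n
          using B by (intro borel_measurable_times hm ind sets.countable_UN' sets.finite_UN; auto)+
      qed (use int in auto)
      moreover have "(\<integral>z. h z * indicator (\<Union>i<n. B i) z \<partial>circle) = (\<Sum>i<n. \<integral>z. h z * indicator (B i) z \<partial>circle)" for n
      proof -
        have "disjoint_family_on B {..<n}"
          using union by (auto simp: disjoint_family_on_def)
        then show ?thesis
          using int_ind[OF B]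
          by (simp add: indicator_UN_disjoint sum_distrib_left flip: Bochner_Integration.integral_sum)
      qed
      ultimately show "(\<lambda>n. \<Sum>i<n. \<integral>z. h z * indicator (B i) z \<partial>circle) \<longlonglongrightarrow> (\<integral>z. h z * indicator (\<Union>i. B i) z \<partial>circle)"
        by simp
    qed
    then show ?case
      using union by (simp add: sums_iff)
  qed auto
qed

text \<open>
  Integrating \<open>h\<close> over the set where its real part is positive gives zero, so that set is null.
\<close>

lemma null_moments_Re_nonpos:
  assumes h: "null_moments h"
  shows "AE z in circle. Re (h z) \<le> 0"
proof -
  have int: "integrable circle h" and hm [measurable]: "h \<in> borel_measurable circle"
    using h by (auto simp: null_moments_def)
  have "{z \<in> space circle. Re (h z) > 0} \<in> sets circle"
    by measurable
  then obtain A where A: "A \<in> sets borel" "{z \<in> space circle. Re (h z) > 0} = sphere 0 1 \<inter> A"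
    by (auto simp: sets_circle sets_restrict_space)
  have [measurable]: "indicator A \<in> borel_measurable circle"
    using A by (intro borel_measurable_circleI) auto
  note int_ind = integrable_mult_indicator[OF int A(1)]
  have eq: "Re (h z * indicator A z) = max 0 (Re (h z))" if "z \<in> space circle" for z
  proof -
    have "z \<in> A \<longleftrightarrow> z \<in> {z \<in> space circle. Re (h z) > 0}"
      using that unfolding A(2) by (simp add: space_circle)
    then show ?thesis using that by (simp add: indicator_def)
  qed
  have "(\<integral>z. Re (h z * indicator A z) \<partial>circle) = 0"
    using integral_Re[OF int_ind] null_moments_borel[OF h A(1)] by simp
  moreover have "AE z in circle. 0 \<le> Re (h z * indicator A z)"
    by (rule AE_I2) (simp only: eq max.cobounded1)
  ultimately have "AE z in circle. Re (h z * indicator A z) = 0"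
    using integral_nonneg_eq_0_iff_AE[OF integrable_Re[OF int_ind]] by blast
  then show ?thesis
    using AE_space
  proof eventually_elim
    case (elim z)
    then show ?case using eq[of z] by linarith
  qed
qed

text \<open>
  The one-sided bound for \<open>h\<close>, \<open>-h\<close>, \<open>\<i> h\<close> and \<open>-\<i> h\<close> determines real and imaginary part.
\<close>

lemma null_moments_AE_zero:
  assumes h: "null_moments h"
  shows "AE z in circle. h z = 0"
proof -
  have "AE z in circle. Re (c * h z) \<le> 0" for c
    by (intro null_moments_Re_nonpos null_moments_cmult h)
  from this[of 1] this[of "-1"] this[of \<i>] this[of "-\<i>"] show ?thesis
    by eventually_elim (auto simp: complex_eq_iff)
qed

section \<open>Fourier expansion\<close>

lemma fourier_coeff_eq_cinner: "fourier_coeff f n = cinner f (monomial n)"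
  by transfer simp

lemma fourier_coeff_eq_0_imp:
  assumes "\<And>n. fourier_coeff f n = 0"
  shows "f = 0"
  using assms
proof (transfer, goal_cases)
  case (1 f)
  then have f: "sq_integrable f" by (simp add: l2_eq_def)
  have "integrable circle f"
    using integrable_mult_cnj[OF f, of "\<lambda>_. 1"] by (simp add: sq_integrable_def)
  moreover have "(\<integral>z. f z * z powi n \<partial>circle) = (\<integral>z. f z * cnj (z powi (- n)) \<partial>circle)" for n
    by (intro Bochner_Integration.integral_cong) (simp_all add: cnj_powi_circle del: complex_cnj_power_int)
  ultimately have "null_moments f"
    using 1(2) by (simp add: null_moments_def)
  then show ?case
    using f null_moments_AE_zero by (simp add: l2_eq_def sq_integrable_zero)
qed

lemma cinner_monomial: "cinner (monomial m) (monomial n) = of_bool (m = n)"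
proof transfer
  fix m n :: int
  have "(\<integral>z. z powi m * cnj (z powi n) \<partial>circle) = (\<integral>z. z powi (m - n) \<partial>circle)"
    by (intro Bochner_Integration.integral_cong)
       (simp_all add: cnj_powi_circle powi_add_circle[of _ m "- n", simplified] del: complex_cnj_power_int)
  then show "(\<integral>z. z powi m * cnj (z powi n) \<partial>circle) = of_bool (m = n)"
    by (simp add: integral_circle_powi)
qed

lemma norm_monomial [simp]: "norm (monomial n) = 1"
proof -
  have "(of_real ((norm (monomial n))\<^sup>2) :: complex) = of_real 1"
    using cinner_self[of "monomial n"] by (simp add: cinner_monomial)
  then have "(norm (monomial n))\<^sup>2 = 1\<^sup>2"
    by (simp only: of_real_eq_iff power_one)
  then show ?thesis
    by (rule power2_eq_imp_eq) simp_all
qed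

lemma bounded_linear_fourier_coeff: "bounded_linear (\<lambda>f. fourier_coeff f n)"
  unfolding fourier_coeff_eq_cinner by (rule bounded_linear_cinner_left)

lemma fourier_coeff_diff: "fourier_coeff (f - g) n = fourier_coeff f n - fourier_coeff g n"
  using bounded_linear_fourier_coeff by (rule linear_diff[OF bounded_linear.linear])

lemma fourier_coeff_scaleC_monomial: "fourier_coeff (c *\<^sub>C monomial m) n = c * of_bool (m = n)"
  by (simp add: fourier_coeff_eq_cinner cinner_scaleC_left cinner_monomial)

lemma fourier_coeff_inject: "(\<And>n. fourier_coeff f n = fourier_coeff g n) \<Longrightarrow> f = g"
  using fourier_coeff_eq_0_imp[of "f - g"] by (simp add: fourier_coeff_diff)

lemma inner_scaleC_monomial: "(c *\<^sub>C monomial m) \<bullet> (d *\<^sub>C monomial n) = Re (c * cnj d) * of_bool (m = n)"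
  by (simp add: inner_l2_def cinner_scaleC_left cinner_scaleC_right cinner_monomial mult.commute)

lemma Bessel_sum:
  assumes "finite F"
  shows "(\<Sum>k\<in>F. (norm (fourier_coeff f k))\<^sup>2) = (norm (\<Sum>k\<in>F. fourier_coeff f k *\<^sub>C monomial k))\<^sup>2"
  using assms by (subst norm_sq_sum_orthogonal) (auto simp: inner_scaleC_monomial norm_scaleC)

text \<open>
  With \<open>s\<close> the partial sum, \<open>f \<bullet> s = \<parallel>s\<parallel>\<^sup>2\<close>, because \<open>f - s\<close> is orthogonal to the monomials
  occurring in \<open>s\<close>.
\<close>

lemma Bessel:
  assumes "finite F"
  shows "norm (\<Sum>k\<in>F. fourier_coeff f k *\<^sub>C monomial k) \<le> norm f"
proof -
  let ?s = "\<Sum>k\<in>F. fourier_coeff f k *\<^sub>C monomial k"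
  have "f \<bullet> ?s = (\<Sum>k\<in>F. (norm (fourier_coeff f k))\<^sup>2)"
  proof (unfold inner_sum_right, rule sum.cong[OF refl])
    fix k
    have "f \<bullet> (fourier_coeff f k *\<^sub>C monomial k) = Re (fourier_coeff f k * cnj (fourier_coeff f k))"
      by (simp add: inner_l2_def cinner_scaleC_right fourier_coeff_eq_cinner)
    then show "f \<bullet> (fourier_coeff f k *\<^sub>C monomial k) = (norm (fourier_coeff f k))\<^sup>2"
      by (simp only: Re_mult_cnj_self)
  qed
  then have "norm ?s * norm ?s = f \<bullet> ?s"
    using Bessel_sum[OF assms, of f] by (simp flip: power2_eq_square)
  also have "\<dots> \<le> norm f * norm ?s"
    by (rule norm_cauchy_schwarz)
  finally show ?thesis
    by (cases "?s = 0") (auto simp: mult_le_cancel_right)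
qed

lemma summable_on_fourier: "(\<lambda>k. fourier_coeff f k *\<^sub>C monomial k) summable_on A"
proof -
  have "(\<lambda>k. fourier_coeff f k *\<^sub>C monomial k) summable_on UNIV"
  proof (rule summable_on_orthogonal)
    fix F :: "int set" assume "finite F"
    then show "(\<Sum>k\<in>F. (norm (fourier_coeff f k *\<^sub>C monomial k))\<^sup>2) \<le> (norm f)\<^sup>2"
      by (simp add: norm_scaleC Bessel_sum Bessel power_mono)
  qed (simp add: inner_scaleC_monomial)
  then show ?thesis
    by (rule summable_on_subset_banach) simp
qed

lemma fourier_coeff_has_sum:
  assumes "((\<lambda>k. c k *\<^sub>C monomial k) has_sum s) A"
  shows "fourier_coeff s n = (if n \<in> A then c n else 0)"
proof -
  have "((\<lambda>k. fourier_coeff (c k *\<^sub>C monomial k) n) has_sum fourier_coeff s n) A"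
    by (rule has_sum_bounded_linear[OF bounded_linear_fourier_coeff assms])
  moreover have "((\<lambda>k. fourier_coeff (c k *\<^sub>C monomial k) n) has_sum (if n \<in> A then c n else 0)) A"
    by (rule has_sum_finite_neutralI[of "{n} \<inter> A"]) (auto simp: fourier_coeff_scaleC_monomial)
  ultimately show ?thesis
    by (rule has_sum_unique)
qed

text \<open>
  By Bessel and completeness the series has a sum; it has the same coefficients as \<open>f\<close>, hence equals
  \<open>f\<close> because only the zero function has vanishing coefficients.
\<close>

lemma has_sum_fourier: "((\<lambda>k. fourier_coeff f k *\<^sub>C monomial k) has_sum f) UNIV"
proof -
  obtain s where s: "((\<lambda>k. fourier_coeff f k *\<^sub>C monomial k) has_sum s) UNIV"
    using summable_on_fourier by (auto simp: summable_on_def)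
  then have "s = f"
    by (intro fourier_coeff_inject) (simp add: fourier_coeff_has_sum)
  then show ?thesis using s by simp
qed

text \<open>
  For \<open>A = {0..}\<close> this produces the vector that is to be \<open>P_plus f\<close>: the projection onto \<open>H2\<close> exists
  because \<open>l2\<close> is complete.
\<close>

lemma ex_fourier_truncation:
  "\<exists>g. \<forall>n. fourier_coeff g n = (if n \<in> A then fourier_coeff f n else 0)"
proof -
  obtain g where "((\<lambda>k. fourier_coeff f k *\<^sub>C monomial k) has_sum g) A"
    using summable_on_fourier by (auto simp: summable_on_def)
  then show ?thesis
    by (intro exI[of _ g]) (simp add: fourier_coeff_has_sum)
qed

section \<open>Multiplication operators\<close>

lemma M_commute: "M \<phi> (M \<psi> f) = M \<psi> (M \<phi> f)"
  by transfer (auto simp: l2_eq_def linf_eq_def ac_simps intro!: sq_integrable_mult)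

lemma M_add: "M \<phi> (f + g) = M \<phi> f + M \<phi> g"
  by transfer (auto simp: l2_eq_def linf_eq_def ring_distribs intro!: sq_integrable_add sq_integrable_mult)

lemma M_scaleC: "M \<phi> (c *\<^sub>C f) = c *\<^sub>C M \<phi> f"
  by transfer (auto simp: l2_eq_def linf_eq_def ac_simps intro!: sq_integrable_cmult sq_integrable_mult)

lemma M_scaleR: "M \<phi> (r *\<^sub>R f) = r *\<^sub>R M \<phi> f"
  by (simp add: scaleR_l2_def M_scaleC)

lemma M_zpow_zpow: "M (zpow m) (M (zpow n) f) = M (zpow (m + n)) f"
  by transfer
     (auto simp: l2_eq_def powi_add_circle ess_bounded_powi intro!: sq_integrable_mult AE_I2)

lemma M_zpow_0 [simp]: "M (zpow 0) f = f"
  by transfer simp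

lemma M_zpow_monomial: "M (zpow m) (monomial n) = monomial (m + n)"
  by transfer
     (auto simp: l2_eq_def powi_add_circle ess_bounded_powi ess_bounded_imp_sq_integrable
       intro!: sq_integrable_mult AE_I2)

lemma norm_M_zpow: "norm (M (zpow n) f) = norm f"
  by transfer
     (simp add: norm_mult norm_powi_circle power_mult_distrib cong: Bochner_Integration.integral_cong)

lemma coord_eq_zpow: "coord = zpow 1"
  by transfer (simp add: linf_eq_def ess_bounded_powi[of 1, simplified])

lemma cinner_M_zpow: "cinner (M (zpow n) f) g = cinner f (M (zpow (- n)) g)"
  by transfer
     (intro Bochner_Integration.integral_cong, auto simp: cnj_powi_circle[symmetric] simp del: complex_cnj_power_int)

lemma bounded_clinear_M: "bounded_clinear (M \<phi>)"
proof -
  have "\<exists>K. \<forall>f. norm (M \<phi> f) \<le> norm f * K"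
  proof transfer
    fix \<phi> assume "linf_eq \<phi> \<phi>"
    then have ess: "ess_bounded \<phi>" by (simp add: linf_eq_def)
    then obtain C where C: "AE z in circle. norm (\<phi> z) \<le> C"
      by (auto simp: ess_bounded_def)
    have "sqrt (\<integral>z. (norm (\<phi> z * f z))\<^sup>2 \<partial>circle) \<le> sqrt (\<integral>z. (norm (f z))\<^sup>2 \<partial>circle) * \<bar>C\<bar>"
      if f: "sq_integrable f" for f
    proof -
      have "(\<integral>z. (norm (\<phi> z * f z))\<^sup>2 \<partial>circle) \<le> (\<integral>z. C\<^sup>2 * (norm (f z))\<^sup>2 \<partial>circle)"
      proof (rule integral_mono_AE)
        show "AE z in circle. (norm (\<phi> z * f z))\<^sup>2 \<le> C\<^sup>2 * (norm (f z))\<^sup>2"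
          using C
        proof eventually_elim
          case (elim z)
          then have "(norm (\<phi> z))\<^sup>2 \<le> C\<^sup>2" by (intro power_mono) auto
          then show ?case
            by (auto simp: norm_mult power_mult_distrib intro: mult_right_mono)
        qed
      qed (use f sq_integrable_mult[OF ess f] in \<open>auto simp: sq_integrable_def\<close>)
      also have "\<dots> = C\<^sup>2 * (\<integral>z. (norm (f z))\<^sup>2 \<partial>circle)" by simp
      finally have "sqrt (\<integral>z. (norm (\<phi> z * f z))\<^sup>2 \<partial>circle) \<le> sqrt (C\<^sup>2 * (\<integral>z. (norm (f z))\<^sup>2 \<partial>circle))"
        by (rule real_sqrt_le_mono)
      then show ?thesis
        by (simp add: real_sqrt_mult mult.commute)
    qed
    then show "\<exists>K. \<forall>f\<in>{x. l2_eq x x}. sqrt (\<integral>z. (norm (\<phi> z * f z))\<^sup>2 \<partial>circle) \<le> sqrt (\<integral>z. (norm (f z))\<^sup>2 \<partial>circle) * K"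
      by (intro exI[of _ "\<bar>C\<bar>"]) (simp add: l2_eq_def)
  qed
  then obtain K where "\<And>f. norm (M \<phi> f) \<le> norm f * K" by blast
  then have "bounded_linear (M \<phi>)"
    by (intro bounded_linear_intro[where K = K] M_add M_scaleR)
  then show ?thesis
    by (simp add: bounded_clinear_def M_scaleC)
qed

lemma M_zero [simp]: "M \<phi> 0 = 0"
  using bounded_clinear_M[of \<phi>] by (simp add: bounded_clinear_def linear_0 bounded_linear.linear)

lemma cinner_eqD:
  assumes "\<And>f. cinner f g = cinner f h"
  shows "g = h"
proof (rule fourier_coeff_inject)
  show "fourier_coeff g n = fourier_coeff h n" for n
    using assms[of "monomial n"] by (metis fourier_coeff_eq_cinner cinner_cnj)
qed

text \<open>
  Since \<open>cnj z = z\<^sup>-\<^sup>1\<close> on the circle, the adjoint is the inverse shift.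
\<close>

lemma cadjoint_M_zpow_1: "cadjoint (M (zpow 1)) = M (zpow (- 1))"
  unfolding cadjoint_def
proof (rule the_equality)
  show "\<forall>f g. cinner (M (zpow 1) f) g = cinner f (M (zpow (- 1)) g)"
    by (simp add: cinner_M_zpow)
next
  fix B :: "l2 \<Rightarrow> l2" assume B: "\<forall>f g. cinner (M (zpow 1) f) g = cinner f (B g)"
  have "B g = M (zpow (- 1)) g" for g
    by (intro cinner_eqD) (simp only: B[rule_format, symmetric] cinner_M_zpow)
  then show "B = M (zpow (- 1))" ..
qed

lemma fourier_coeff_M_zpow: "fourier_coeff (M (zpow m) f) n = fourier_coeff f (n - m)"
  by (simp add: fourier_coeff_eq_cinner cinner_M_zpow M_zpow_monomial)

section \<open>The projections $P_+$ and $P_-$\<close>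

text \<open>
  Vectors with disjoint spectra are orthogonal: every term of the expansion of \<open>cinner f g\<close> in the
  monomials vanishes.
\<close>

lemma cinner_Parseval_0:
  assumes "\<And>n. fourier_coeff f n = 0 \<or> fourier_coeff g n = 0"
  shows "cinner f g = 0"
proof -
  have "((\<lambda>k. cinner (fourier_coeff f k *\<^sub>C monomial k) g) has_sum cinner f g) UNIV"
    by (rule has_sum_bounded_linear[OF bounded_linear_cinner_left has_sum_fourier])
  moreover have "cinner (fourier_coeff f k *\<^sub>C monomial k) g = 0" for k
    using assms[of k] cinner_cnj[of g "monomial k"]
    by (auto simp: cinner_scaleC_left fourier_coeff_eq_cinner)
  ultimately have "((\<lambda>k :: int. 0 :: complex) has_sum cinner f g) UNIV"
    by simp
  then show ?thesis
    by (rule has_sum_unique) (simp add: has_sum_0)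
qed

text \<open>
  The truncation \<open>g\<close> of \<open>f\<close> to nonnegative frequencies lies in \<open>H2\<close>, and \<open>f - g\<close> has only negative
  frequencies, so it is orthogonal to \<open>H2\<close>. Testing against the monomials in \<open>H2\<close> shows that no
  other vector has this property.
\<close>

lemma fourier_coeff_P_plus: "fourier_coeff (P_plus f) n = (if n \<ge> 0 then fourier_coeff f n else 0)"
proof -
  obtain g where g: "\<And>n. fourier_coeff g n = (if n \<ge> 0 then fourier_coeff f n else 0)"
    using ex_fourier_truncation[of "{0..}" f] by auto
  have "P_plus f = g"
    unfolding P_plus_def orth_proj_def
  proof (rule the_equality)
    show "g \<in> H2 \<and> (\<forall>h\<in>H2. cinner (f - g) h = 0)"
      by (auto simp: H2_def g fourier_coeff_diff intro!: cinner_Parseval_0)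
  next
    fix g' assume g': "g' \<in> H2 \<and> (\<forall>h\<in>H2. cinner (f - g') h = 0)"
    show "g' = g"
    proof (rule fourier_coeff_inject)
      fix n
      show "fourier_coeff g' n = fourier_coeff g n"
      proof (cases "n \<ge> 0")
        case True
        then have "monomial n \<in> H2"
          by (auto simp: H2_def fourier_coeff_eq_cinner cinner_monomial)
        then have "fourier_coeff (f - g') n = 0"
          using g' by (simp add: fourier_coeff_eq_cinner)
        then show ?thesis using True by (simp add: g fourier_coeff_diff)
      next
        case False
        then show ?thesis using g' by (simp add: g H2_def)
      qed
    qed
  qed
  then show ?thesis by (simp add: g)
qed

lemma fourier_coeff_P_minus: "fourier_coeff (P_minus f) n = (if n < 0 then fourier_coeff f n else 0)"
  by (simp add: P_minus_def fourier_coeff_diff fourier_coeff_P_plus)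

lemma P_plus_add_P_minus: "P_plus f + P_minus f = f"
  by (simp add: P_minus_def)

lemma P_plus_eq_self:
  assumes "\<And>n. n < 0 \<Longrightarrow> fourier_coeff f n = 0"
  shows "P_plus f = f"
  by (rule fourier_coeff_inject) (simp add: fourier_coeff_P_plus assms)

lemma P_plus_eq_0:
  assumes "\<And>n. n \<ge> 0 \<Longrightarrow> fourier_coeff f n = 0"
  shows "P_plus f = 0"
proof (rule fourier_coeff_inject)
  show "fourier_coeff (P_plus f) n = fourier_coeff 0 n" for n
    using linear_0[OF bounded_linear.linear[OF bounded_linear_fourier_coeff]]
    by (simp add: fourier_coeff_P_plus assms)
qed

lemma fourier_coeff_monomial: "fourier_coeff (monomial m) n = of_bool (m = n)"
  by (simp add: fourier_coeff_eq_cinner cinner_monomial)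

lemma P_monomial:
  "n \<ge> 0 \<Longrightarrow> P_plus (monomial n) = monomial n" "n \<ge> 0 \<Longrightarrow> P_minus (monomial n) = 0"
  "n < 0 \<Longrightarrow> P_plus (monomial n) = 0" "n < 0 \<Longrightarrow> P_minus (monomial n) = monomial n"
  by (auto simp: P_minus_def P_plus_eq_self P_plus_eq_0 fourier_coeff_monomial)

section \<open>Operators determined by the monomials, and bounded symbols\<close>

text \<open>
  The operators may be applied to the Fourier expansion term by term; for \<open>f\<close> in the range of one of
  the projections only half of the monomials occur.
\<close>

lemma bounded_clinear_eqI:
  assumes A: "bounded_clinear A" and B: "bounded_clinear B"
    and eq: "\<And>k. fourier_coeff f k \<noteq> 0 \<Longrightarrow> A (monomial k) = B (monomial k)"
  shows "A f = B f"
proof -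
  have sum: "((\<lambda>k. fourier_coeff f k *\<^sub>C T (monomial k)) has_sum T f) UNIV" if "bounded_clinear T" for T
  proof -
    have "((\<lambda>k. T (fourier_coeff f k *\<^sub>C monomial k)) has_sum T f) UNIV"
      using that by (intro has_sum_bounded_linear[OF _ has_sum_fourier]) (simp add: bounded_clinear_def)
    then show ?thesis
      using that by (simp add: bounded_clinear_def)
  qed
  have zero: "0 *\<^sub>C x = 0 *\<^sub>C y" for x y
    by transfer (auto simp: l2_eq_def sq_integrable_zero)
  have "fourier_coeff f k *\<^sub>C A (monomial k) = fourier_coeff f k *\<^sub>C B (monomial k)" for k
    using eq[of k] zero by metis
  then show ?thesis
    using sum[OF A] sum[OF B] has_sum_unique by (metis (no_types, lifting) has_sum_cong)
qed

lemma cinner_sum_left: "cinner (\<Sum>i\<in>F. v i) g = (\<Sum>i\<in>F. cinner (v i) g)"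
  by (rule linear_sum[OF bounded_linear.linear[OF bounded_linear_cinner_left]])

lemma bounded_clinear_sum:
  assumes "bounded_clinear A"
  shows "A (\<Sum>i\<in>F. c i *\<^sub>C v i) = (\<Sum>i\<in>F. c i *\<^sub>C A (v i))"
  using assms by (simp add: bounded_clinear_def linear_sum[OF bounded_linear.linear])

text \<open>
  Apply the bound to the partial sums of the Fourier series of \<open>g\<close>, whose norms do not exceed that
  of \<open>g\<close> by Bessel's inequality, and pass to the limit.
\<close>

lemma cinner_bounded_on_trig_polynomials:
  assumes "\<And>F c. finite F \<Longrightarrow> norm (cinner (\<Sum>k\<in>F. c k *\<^sub>C monomial k) w) \<le> K * norm (\<Sum>k\<in>F. c k *\<^sub>C monomial k)"
    and "K \<ge> 0"
  shows "norm (cinner g w) \<le> K * norm g"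
proof -
  have "((\<lambda>k. cinner (fourier_coeff g k *\<^sub>C monomial k) w) has_sum cinner g w) UNIV"
    by (rule has_sum_bounded_linear[OF bounded_linear_cinner_left has_sum_fourier])
  then have "((\<lambda>F. norm (\<Sum>k\<in>F. cinner (fourier_coeff g k *\<^sub>C monomial k) w)) \<longlongrightarrow> norm (cinner g w)) (finite_subsets_at_top UNIV)"
    unfolding has_sum_def by (rule tendsto_norm)
  then show ?thesis
  proof (rule tendsto_upperbound)
    show "\<forall>\<^sub>F F in finite_subsets_at_top UNIV. norm (\<Sum>k\<in>F. cinner (fourier_coeff g k *\<^sub>C monomial k) w) \<le> K * norm g"
    proof (rule eventually_finite_subsets_at_top_weakI)
      fix F :: "int set" assume F: "finite F"
      have "norm (\<Sum>k\<in>F. cinner (fourier_coeff g k *\<^sub>C monomial k) w) \<le> K * norm (\<Sum>k\<in>F. fourier_coeff g k *\<^sub>C monomial k)"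
        using assms(1)[OF F] by (simp add: cinner_sum_left)
      also have "\<dots> \<le> K * norm g"
        using Bessel[OF F] \<open>K \<ge> 0\<close> by (rule mult_left_mono)
      finally show "norm (\<Sum>k\<in>F. cinner (fourier_coeff g k *\<^sub>C monomial k) w) \<le> K * norm g" .
    qed
  qed simp
qed

text \<open>
  If multiplying trigonometric polynomials by the square integrable function \<open>\<phi>\<close> is bounded by \<open>K\<close>,
  then \<open>\<bar>\<phi>\<bar> \<le> K\<close> almost everywhere. To see this, let \<open>q\<close> be the indicator of the set where
  \<open>K < \<bar>\<phi>\<bar> \<le> m\<close>. The truncation at \<open>m\<close> makes \<open>u = \<phi> q\<close> and \<open>w = cnj \<phi> * \<phi> q\<close> bounded,
  and moving \<open>\<phi>\<close> across the inner product gives \<open>\<langle>T, w\<rangle> = \<langle>\<phi> T, u\<rangle>\<close>, which is at most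
  \<open>K \<parallel>T\<parallel> \<parallel>u\<parallel>\<close>, for every trigonometric polynomial \<open>T\<close>. By density the same holds with \<open>q\<close> in place
  of \<open>T\<close>. As \<open>\<langle>q, w\<rangle> = \<parallel>u\<parallel>\<^sup>2\<close>, this says \<open>\<parallel>\<phi> q\<parallel> \<le> K \<parallel>q\<parallel>\<close>, although \<open>\<bar>\<phi>\<bar> > K\<close> wherever
  \<open>q\<close> is nonzero; so \<open>q\<close> vanishes almost everywhere.
\<close>

lemma bounded_multiplier:
  assumes bound: "\<And>F c. finite F \<Longrightarrow>
      norm (\<Sum>k\<in>F. c k *\<^sub>C M (zpow k) \<phi>) \<le> K * norm (\<Sum>k\<in>F. c k *\<^sub>C monomial k)"
  shows "\<exists>\<Phi>. \<phi> = M \<Phi> (monomial 0)"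
proof -
  obtain p where p: "sq_integrable p" "\<phi> = abs_l2 p" by (rule l2_cases)
  have [measurable]: "p \<in> borel_measurable circle" using p by (simp add: sq_integrable_def)
  \<comment> \<open>The hypothesis for the constant polynomial forces \<open>K \<ge> 0\<close>.\<close>
  have "norm ((1::complex) *\<^sub>C \<phi>) \<le> K * norm ((1::complex) *\<^sub>C monomial 0)"
    using bound[of "{0}" "\<lambda>_. 1"] by simp
  then have K: "K \<ge> 0"
    by (simp add: norm_scaleC) (use norm_ge_zero order_trans in blast)
  have null: "AE z in circle. \<not> (K < norm (p z) \<and> norm (p z) \<le> real m)" for m
  proof -
    define q where "q z = (of_bool (K < norm (p z) \<and> norm (p z) \<le> real m) :: complex)" for z
    have [measurable]: "q \<in> borel_measurable circle"
      unfolding q_def by measurable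
    have cnjp [measurable]: "(\<lambda>z. cnj (p z)) \<in> borel_measurable circle"
      by (rule measurable_compose[OF _ borel_measurable_continuous_onI, of p])
         (auto intro: continuous_intros)
    have sq: "sq_integrable q" "sq_integrable (\<lambda>z. p z * q z)" "sq_integrable (\<lambda>z. cnj (p z) * (p z * q z))"
      by (intro ess_bounded_imp_sq_integrable ess_boundedI[of _ 1] ess_boundedI[of _ "real m"]
          ess_boundedI[of _ "real m * real m"] borel_measurable_times cnjp;
          auto simp: q_def norm_mult intro: mult_mono)+
    define g where "g = abs_l2 q"
    define u where "u = abs_l2 (\<lambda>z. p z * q z)"
    define w where "w = abs_l2 (\<lambda>z. cnj (p z) * (p z * q z))"
    have move: "cinner (M (zpow k) \<phi>) u = cinner (monomial k) w" for k
      using sq p sq_integrable_mult[OF ess_bounded_powi p(1)]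
      by (simp add: u_def w_def p(2) zpow.abs_eq monomial.abs_eq M.abs_eq cinner.abs_eq linf_eq_def l2_eq_def
          ess_bounded_powi ess_bounded_imp_sq_integrable ac_simps)
    have "norm (cinner g w) \<le> (K * norm u) * norm g"
    proof (rule cinner_bounded_on_trig_polynomials)
      fix F :: "int set" and c assume F: "finite F"
      have "cinner (\<Sum>k\<in>F. c k *\<^sub>C monomial k) w = cinner (\<Sum>k\<in>F. c k *\<^sub>C M (zpow k) \<phi>) u"
        by (simp add: cinner_sum_left cinner_scaleC_left move)
      also have "norm \<dots> \<le> norm (\<Sum>k\<in>F. c k *\<^sub>C M (zpow k) \<phi>) * norm u"
        by (rule norm_cinner_le)
      also have "\<dots> \<le> (K * norm (\<Sum>k\<in>F. c k *\<^sub>C monomial k)) * norm u"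
        by (intro mult_right_mono bound F) simp
      finally show "norm (cinner (\<Sum>k\<in>F. c k *\<^sub>C monomial k) w) \<le> K * norm u * norm (\<Sum>k\<in>F. c k *\<^sub>C monomial k)"
        by (simp add: ac_simps)
    qed (use K in simp)
    moreover have "cinner g w = cinner u u"
      using sq by (simp add: g_def u_def w_def cinner.abs_eq l2_eq_def ac_simps)
    ultimately have "norm u * norm u \<le> norm u * (K * norm g)"
      by (simp add: cinner_self norm_mult power2_eq_square ac_simps)
    then have "norm u \<le> K * norm g"
      using K by (cases "norm u = 0") (auto simp: mult_le_cancel_left)
    then have "(norm u)\<^sup>2 \<le> (K * norm g)\<^sup>2"
      by (rule power_mono) simp
    moreover have "(norm u)\<^sup>2 = (\<integral>z. (norm (p z * q z))\<^sup>2 \<partial>circle)" "(norm g)\<^sup>2 = (\<integral>z. (norm (q z))\<^sup>2 \<partial>circle)"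
      using sq by (simp_all add: g_def u_def norm_l2.abs_eq l2_eq_def)
    ultimately have "(\<integral>z. (norm (p z * q z))\<^sup>2 \<partial>circle) \<le> (\<integral>z. K\<^sup>2 * (norm (q z))\<^sup>2 \<partial>circle)"
      by (simp add: power_mult_distrib)
    then have le: "(\<integral>z. (norm (p z * q z))\<^sup>2 - K\<^sup>2 * (norm (q z))\<^sup>2 \<partial>circle) \<le> 0"
      using sq by (subst Bochner_Integration.integral_diff) (auto simp: sq_integrable_def)
    have nonneg: "0 \<le> (norm (p z * q z))\<^sup>2 - K\<^sup>2 * (norm (q z))\<^sup>2" for z
      using K by (auto simp: q_def norm_mult intro!: power_mono)
    have int: "integrable circle (\<lambda>z. (norm (p z * q z))\<^sup>2 - K\<^sup>2 * (norm (q z))\<^sup>2)"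
      using sq by (intro Bochner_Integration.integrable_diff) (auto simp: sq_integrable_def)
    have "(\<integral>z. (norm (p z * q z))\<^sup>2 - K\<^sup>2 * (norm (q z))\<^sup>2 \<partial>circle) = 0"
      using le nonneg by (intro antisym) auto
    then have "AE z in circle. (norm (p z * q z))\<^sup>2 - K\<^sup>2 * (norm (q z))\<^sup>2 = 0"
      using integral_nonneg_eq_0_iff_AE[OF int] nonneg by simp
    then show ?thesis
    proof eventually_elim
      case (elim z)
      show ?case
      proof
        assume z: "K < norm (p z) \<and> norm (p z) \<le> real m"
        then have "K\<^sup>2 < (norm (p z))\<^sup>2"
          using K by (intro power_strict_mono) auto
        then show False
          using elim z by (simp add: q_def)
      qed
    qed
  qed
  have "AE z in circle. \<forall>m. \<not> (K < norm (p z) \<and> norm (p z) \<le> real m)"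
    unfolding AE_all_countable using null by blast
  then have "AE z in circle. norm (p z) \<le> K"
    by eventually_elim (meson linorder_not_le real_arch_simple)
  then have ess: "ess_bounded p"
    by (auto simp: ess_bounded_def)
  have "M (abs_linf p) (monomial 0) = \<phi>"
    using ess p
    by (simp add: monomial.abs_eq M.abs_eq linf_eq_def l2_eq_def ess_bounded_powi[of 0, simplified] ess_bounded_imp_sq_integrable)
  then show ?thesis by metis
qed

text \<open>
  An operator that acts on the monomials with exponents in \<open>I\<close> as multiplication by the square
  integrable function \<open>\<phi>\<close> has a bounded symbol there. Multiplication by \<open>z\<^sup>N\<close> is isometric and
  commutes with multiplication by \<open>\<phi>\<close>, so a trigonometric polynomial may first be shifted until all its
  exponents lie in \<open>I\<close>, where the product with \<open>\<phi>\<close> is the image under \<open>X\<close>. The operator norm of \<open>X\<close> then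
  bounds \<open>\<phi>\<close>.
\<close>

lemma ex_symbol:
  assumes X: "bounded_clinear X"
    and eq: "\<And>n. n \<in> I \<Longrightarrow> X (monomial n) = M (zpow n) \<phi>"
    and shift: "\<And>F. finite F \<Longrightarrow> \<exists>N. \<forall>k\<in>F. N + k \<in> I"
  shows "\<exists>\<Phi>. \<forall>n\<in>I. X (monomial n) = M \<Phi> (monomial n)"
proof -
  obtain K where K: "\<And>f. norm (X f) \<le> norm f * K"
    using X unfolding bounded_clinear_def by (meson bounded_linear.bounded)
  have "norm (\<Sum>k\<in>F. c k *\<^sub>C M (zpow k) \<phi>) \<le> K * norm (\<Sum>k\<in>F. c k *\<^sub>C monomial k)"
    if F: "finite F" for F c
  proof -
    obtain N where N: "\<And>k. k \<in> F \<Longrightarrow> N + k \<in> I" using shift[OF F] by blast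
    have "norm (\<Sum>k\<in>F. c k *\<^sub>C M (zpow k) \<phi>) = norm (M (zpow N) (\<Sum>k\<in>F. c k *\<^sub>C M (zpow k) \<phi>))"
      by (simp add: norm_M_zpow)
    also have "M (zpow N) (\<Sum>k\<in>F. c k *\<^sub>C M (zpow k) \<phi>) = (\<Sum>k\<in>F. c k *\<^sub>C X (monomial (N + k)))"
      by (simp add: bounded_clinear_sum[OF bounded_clinear_M] M_zpow_zpow eq N)
    also have "\<dots> = X (M (zpow N) (\<Sum>k\<in>F. c k *\<^sub>C monomial k))"
      by (simp add: bounded_clinear_sum[OF bounded_clinear_M] bounded_clinear_sum[OF X] M_zpow_monomial)
    also have "norm \<dots> \<le> norm (M (zpow N) (\<Sum>k\<in>F. c k *\<^sub>C monomial k)) * K"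
      by (rule K)
    finally show ?thesis
      by (simp add: norm_M_zpow mult.commute)
  qed
  from bounded_multiplier[OF this] obtain \<Phi> where \<Phi>: "\<phi> = M \<Phi> (monomial 0)" by blast
  have "X (monomial n) = M \<Phi> (monomial n)" if "n \<in> I" for n
    using M_commute[of "zpow n" \<Phi> "monomial 0"] by (simp add: eq[OF that] \<Phi> M_zpow_monomial)
  then show ?thesis by blast
qed

section \<open>Paired operators\<close>

lemma M_monomial_inject:
  assumes "M \<phi> (monomial n) = M \<psi> (monomial n)"
  shows "\<phi> = \<psi>"
  using assms
proof transfer
  fix \<phi> \<psi> and n :: int
  assume *: "linf_eq \<phi> \<phi>" "linf_eq \<psi> \<psi>" "l2_eq (\<lambda>z. \<phi> z * z powi n) (\<lambda>z. \<psi> z * z powi n)"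
  then have "AE z in circle. \<phi> z * z powi n = \<psi> z * z powi n"
    by (simp add: l2_eq_def)
  then have "AE z in circle. \<phi> z = \<psi> z"
    using AE_space
  proof eventually_elim
    case (elim z)
    then show ?case using norm_powi_circle[of z n] by auto
  qed
  then show "linf_eq \<phi> \<psi>"
    using * by (simp add: linf_eq_def)
qed

lemma paired_monomial:
  "n \<ge> 0 \<Longrightarrow> paired \<phi> \<psi> (monomial n) = M \<phi> (monomial n)"
  "n < 0 \<Longrightarrow> paired \<phi> \<psi> (monomial n) = M \<psi> (monomial n)"
  by (simp_all add: paired_def P_monomial)

lemma paired_unique:
  assumes "paired \<phi> \<psi> = paired \<phi>' \<psi>'"
  shows "\<phi> = \<phi>' \<and> \<psi> = \<psi>'"
proof -
  have "M \<phi> (monomial 0) = M \<phi>' (monomial 0)" "M \<psi> (monomial (- 1)) = M \<psi>' (monomial (- 1))"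
    using fun_cong[OF assms, of "monomial 0"] fun_cong[OF assms, of "monomial (- 1)"] by (simp_all add: paired_monomial)
  then show ?thesis by (auto dest: M_monomial_inject)
qed

text \<open>
  Both arguments of \<open>paired \<phi> \<psi>\<close> on the right stay within one half of the spectrum: \<open>z P_plus f\<close> has
  only nonnegative, and \<open>z\<^sup>-\<^sup>1 P_minus f\<close> only negative frequencies. There the operator is a single
  multiplication, which commutes with the shifts.
\<close>

lemma paired_fixed:
  "paired \<phi> \<psi> f = M (zpow (- 1)) (paired \<phi> \<psi> (M (zpow 1) (P_plus f)))
      + M (zpow 1) (paired \<phi> \<psi> (M (zpow (- 1)) (P_minus f)))"
proof -
  have "P_plus (M (zpow 1) (P_plus f)) = M (zpow 1) (P_plus f)"
    by (intro P_plus_eq_self) (simp add: fourier_coeff_M_zpow fourier_coeff_P_plus)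
  moreover have "P_plus (M (zpow (- 1)) (P_minus f)) = 0"
    by (intro P_plus_eq_0) (simp add: fourier_coeff_M_zpow fourier_coeff_P_minus)
  ultimately have "paired \<phi> \<psi> (M (zpow 1) (P_plus f)) = M (zpow 1) (M \<phi> (P_plus f))"
    "paired \<phi> \<psi> (M (zpow (- 1)) (P_minus f)) = M (zpow (- 1)) (M \<psi> (P_minus f))"
    by (simp_all add: paired_def P_minus_def[of "M _ _"] M_commute[of "zpow _"])
  then show ?thesis
    by (simp add: M_zpow_zpow paired_def)
qed

text \<open>
  On the monomials the identity becomes a recursion outward from the exponents \<open>0\<close> and \<open>-1\<close>, with solution
  \<open>X z\<^sup>n = z\<^sup>n X 1\<close> for \<open>n \<ge> 0\<close> and \<open>X z\<^sup>n = z\<^sup>n (z X z\<^sup>-\<^sup>1)\<close> for \<open>n < 0\<close>.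
  The symbols are therefore \<open>X 1\<close> and \<open>z X z\<^sup>-\<^sup>1\<close>, which \<open>ex_symbol\<close> shows to be bounded
  functions.
\<close>

lemma fixed_imp_is_paired:
  assumes X: "bounded_clinear X"
    and fixed: "\<And>f. X f = M (zpow (- 1)) (X (M (zpow 1) (P_plus f)))
      + M (zpow 1) (X (M (zpow (- 1)) (P_minus f)))"
  shows "is_paired X"
proof -
  have X0: "X 0 = 0"
    using X by (simp add: bounded_clinear_def linear_0 bounded_linear.linear)
  have up: "X (monomial (n + 1)) = M (zpow 1) (X (monomial n))" if "n \<ge> 0" for n
    using fixed[of "monomial n"] that by (simp add: P_monomial M_zpow_monomial X0 M_zpow_zpow add.commute)
  have down: "X (monomial (n - 1)) = M (zpow (- 1)) (X (monomial n))" if "n < 0" for n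
    using fixed[of "monomial n"] that by (simp add: P_monomial M_zpow_monomial X0 M_zpow_zpow)
  have pos: "X (monomial n) = M (zpow n) (X (monomial 0))" if "n \<ge> 0" for n
    using that by (induction n rule: int_ge_induct) (simp_all add: up M_zpow_zpow add.commute)
  have neg: "X (monomial n) = M (zpow n) (M (zpow 1) (X (monomial (- 1))))" if "n \<le> - 1" for n
    using that by (induction n rule: int_le_induct) (simp_all add: down M_zpow_zpow)
  obtain \<phi> where \<phi>: "\<And>n. n \<ge> 0 \<Longrightarrow> X (monomial n) = M \<phi> (monomial n)"
  proof -
    have "\<exists>N. \<forall>k\<in>F. N + k \<in> {0..}" if "finite F" for F :: "int set"
    proof (intro exI ballI)
      fix k assume "k \<in> F"
      then have "\<bar>k\<bar> \<le> (\<Sum>k\<in>F. \<bar>k\<bar>)" using that by (intro member_le_sum) auto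
      then show "(\<Sum>k\<in>F. \<bar>k\<bar>) + k \<in> {0..}" by auto
    qed
    then have "\<exists>\<phi>. \<forall>n\<in>{0..}. X (monomial n) = M \<phi> (monomial n)"
      by (intro ex_symbol[OF X pos]) simp_all
    then show ?thesis using that by (meson atLeast_iff)
  qed
  obtain \<psi> where \<psi>: "\<And>n. n < 0 \<Longrightarrow> X (monomial n) = M \<psi> (monomial n)"
  proof -
    have "\<exists>N. \<forall>k\<in>F. N + k \<in> {..<0}" if "finite F" for F :: "int set"
    proof (intro exI ballI)
      fix k assume "k \<in> F"
      then have "\<bar>k\<bar> \<le> (\<Sum>k\<in>F. \<bar>k\<bar>)" using that by (intro member_le_sum) auto
      then show "- 1 - (\<Sum>k\<in>F. \<bar>k\<bar>) + k \<in> {..<0}" by auto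
    qed
    then have "\<exists>\<psi>. \<forall>n\<in>{..<0}. X (monomial n) = M \<psi> (monomial n)"
      by (intro ex_symbol[OF X neg]) simp_all
    then show ?thesis using that by (meson lessThan_iff)
  qed
  have "X f = paired \<phi> \<psi> f" for f
  proof -
    have "X f = X (P_plus f) + X (P_minus f)"
      using X linear_add[of X "P_plus f" "P_minus f"]
      by (simp add: bounded_clinear_def bounded_linear.linear P_plus_add_P_minus)
    also have "X (P_plus f) = M \<phi> (P_plus f)"
      by (rule bounded_clinear_eqI[OF X bounded_clinear_M])
         (simp add: fourier_coeff_P_plus \<phi> split: if_splits)
    also have "X (P_minus f) = M \<psi> (P_minus f)"
      by (rule bounded_clinear_eqI[OF X bounded_clinear_M])
         (simp add: fourier_coeff_P_minus \<psi> split: if_splits)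
    finally show ?thesis by (simp add: paired_def)
  qed
  then show ?thesis unfolding is_paired_def by blast
qed

theorem theorem4p1:
  fixes X :: "l2 \<Rightarrow> l2"
  assumes "bounded_clinear X"
  shows "(is_paired X \<longleftrightarrow>
           X = (\<lambda>f. cadjoint (M coord) (X (M coord (P_plus f)))
                   + M coord (X (cadjoint (M coord) (P_minus f)))))
       \<and> (\<forall>\<phi> \<psi> \<phi>' \<psi>'. X = paired \<phi> \<psi> \<longrightarrow> X = paired \<phi>' \<psi>' \<longrightarrow> \<phi> = \<phi>' \<and> \<psi> = \<psi>')"
proof (intro conjI iffI allI impI)
  assume "is_paired X"
  then show "X = (\<lambda>f. cadjoint (M coord) (X (M coord (P_plus f)))
      + M coord (X (cadjoint (M coord) (P_minus f))))"
    unfolding is_paired_def coord_eq_zpow cadjoint_M_zpow_1 using paired_fixed by blast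
next
  assume "X = (\<lambda>f. cadjoint (M coord) (X (M coord (P_plus f)))
      + M coord (X (cadjoint (M coord) (P_minus f))))"
  from fun_cong[OF this] show "is_paired X"
    unfolding coord_eq_zpow cadjoint_M_zpow_1 by (rule fixed_imp_is_paired[OF assms])
qed (use paired_unique in blast)+

end
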